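(* If $C$ is a closed convex curve in the plane, enclosing area $A$, with diameter $D$ and minimum halving distance $h$, then $A\le D\,h$.
   Context: A closed convex curve is the boundary of a planar convex body. The diameter is $D=\max\{|pq| : p,q\in C\}$. A halving pair of $C$ consists of two points $p,\hat p\in C$ dividing $C$ into two arcs of equal length $|C|/2$, where $|C|$ is the length of $C$; $h$ is the minimum of $|p\hat p|$ over all halving pairs. *)

theory Defs
  imports "HOL-Analysis.Analysis"
begin

definition closed_convex_curve :: "(real^2) set \<Rightarrow> bool" where
  "closed_convex_curve C \<longleftrightarrow>
     (\<exists>K. convex K \<and> compact K \<and> interior K \<noteq> {} \<and> C = frontier K)"

(* Supremum of the lengths of inscribed polygonal chains; infinite for non-rectifiable paths. *)
definition path_length :: "(real \<Rightarrow> 'a::metric_space) \<Rightarrow> ennreal" where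
  "path_length g =
     (SUP (n, t) \<in> {(n::nat, t::nat \<Rightarrow> real). mono t \<and> range t \<subseteq> {0..1}}.
        \<Sum>i<n. ennreal (dist (g (t i)) (g (t (Suc i)))))"

(* The curve C is traversed once by a simple loop g starting at p; the point q = g t splits it
   into two arcs, and |C| is the length of g (the same for every such g). *)
definition halving_pair :: "(real^2) set \<Rightarrow> real^2 \<Rightarrow> real^2 \<Rightarrow> bool" where
  "halving_pair C p q \<longleftrightarrow>
     (\<exists>g t. simple_path g \<and> pathfinish g = pathstart g \<and> path_image g = C \<and>
        t \<in> {0<..<1} \<and> pathstart g = p \<and> g t = q \<and>
        path_length (subpath 0 t g) = path_length g / 2 \<and>
        path_length (subpath t 1 g) = path_length g / 2)"

(* For a closed convex curve this set is nonempty and compact, so its infimum is its minimum. *)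
definition min_halving_distance :: "(real^2) set \<Rightarrow> real" where
  "min_halving_distance C = Inf {dist p q |p q. halving_pair C p q}"

definition enclosed_area :: "(real^2) set \<Rightarrow> real" where
  "enclosed_area C = measure lebesgue (inside C)"

end

theory Submission
  imports Defs "HOL-Complex_Analysis.Contour_Integration"
begin

text \<open>
  Let \<open>p\<close>, \<open>q\<close> be any halving pair and \<open>l = |pq|\<close>; let \<open>a\<close> and \<open>b\<close> be the extents of the body on the
  two sides of the line \<open>pq\<close>, where \<open>a \<le> b\<close>. If a chord \<open>uv\<close> parallel to \<open>pq\<close>, on the wider side
  at distance \<open>\<beta> > a\<close>, were longer than \<open>l\<close>, then the lines \<open>up\<close> and \<open>vq\<close> would enclose the narrower
  side in a trapezoid of height \<open>a\<close> whose legs are \<open>a / \<beta> < 1\<close> times as long as \<open>up\<close> and \<open>vq\<close>; the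
  arc on the narrower side would be shorter than the other one. So sections at distance more than \<open>a\<close>
  have length at most \<open>l\<close>, while by convexity the two sections at distance \<open>x \<le> a\<close> on opposite sides
  have total length at most \<open>2l\<close>. Integration gives \<open>A \<le> l (a + b) \<le> l D\<close>.

  Lengths of convex arcs are bounded above because the nearest-point projection onto a convex set
  is 1-Lipschitz. A halving pair exists because the lengths of the two arcs are lower
  semicontinuous functions with constant finite sum, hence continuous.
\<close>

subsection \<open>Length of paths\<close>

lemma chain_le_path_length:
  assumes "mono t" "range t \<subseteq> {0..1}"
  shows "(\<Sum>i<n. ennreal (dist (g (t i)) (g (t (Suc i))))) \<le> path_length g"
  unfolding path_length_def using assms by (intro SUP_upper2[of "(n, t)"]) auto

lemma path_length_least:
  assumes "\<And>n t. mono t \<Longrightarrow> range t \<subseteq> {0..1} \<Longrightarrow>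
    (\<Sum>i<n. ennreal (dist (g (t i)) (g (t (Suc i))))) \<le> B"
  shows "path_length g \<le> B"
  unfolding path_length_def using assms by (intro SUP_least) auto

lemma path_length_constant:
  assumes "\<And>s. s \<in> {0..1} \<Longrightarrow> g s = c"
  shows "path_length g = 0"
proof -
  have "path_length g \<le> 0"
  proof (rule path_length_least)
    fix n :: nat and t :: "nat \<Rightarrow> real" assume "range t \<subseteq> {0..1}"
    then have "t i \<in> {0..1}" for i by (simp add: image_subset_iff)
    then show "(\<Sum>i<n. ennreal (dist (g (t i)) (g (t (Suc i))))) \<le> 0" using assms by simp
  qed
  then show ?thesis by simp
qed

text \<open>Affine reparametrization turns the chain into one for the subpath. If
  \<open>a < b\<close> fails, the range condition makes the chain constant.\<close>

lemma subchain_le_path_length: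
  assumes "mono t" "range t \<subseteq> {a..b}"
  shows "(\<Sum>i<n. ennreal (dist (g (t i)) (g (t (Suc i))))) \<le> path_length (subpath a b g)"
proof (cases "a < b")
  case True
  define s where "s i = (t i - a) / (b - a)" for i
  have rt: "a \<le> t i \<and> t i \<le> b" for i using assms by (simp add: image_subset_iff)
  have "mono s" using assms True by (auto simp: s_def mono_def divide_right_mono)
  moreover have "range s \<subseteq> {0..1}" using rt True by (auto simp: s_def)
  ultimately have "(\<Sum>i<n. ennreal (dist (subpath a b g (s i)) (subpath a b g (s (Suc i)))))
      \<le> path_length (subpath a b g)"
    by (rule chain_le_path_length)
  moreover have "subpath a b g (s i) = g (t i)" for i
    using True by (simp add: subpath_def s_def)
  ultimately show ?thesis by simp
next
  case False
  have "t i = a" for i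
    using assms(2)[unfolded image_subset_iff, THEN bspec, of i] False by auto
  then show ?thesis by simp
qed

lemma path_length_ge_2:
  assumes "s \<in> {0..1}"
  shows "ennreal (dist (g 0) (g s) + dist (g s) (g 1)) \<le> path_length g"
proof -
  \<comment> \<open>Chains are functions on all of \<open>nat\<close>, so the finite sequence 0,
    \<open>s\<close>, 1 is continued by the constant 1.\<close>
  define t :: "nat \<Rightarrow> real" where "t i = (if i = 0 then 0 else if i = 1 then s else 1)" for i
  have "(\<Sum>i<2. ennreal (dist (g (t i)) (g (t (Suc i))))) \<le> path_length g"
    using assms by (intro chain_le_path_length) (auto simp: t_def mono_def)
  then show ?thesis by (simp add: numeral_2_eq_2 t_def ennreal_plus)
qed

lemma path_length_ge_3:
  assumes "s \<in> {0..1}" "s' \<in> {0..1}" "s \<le> s'"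
  shows "ennreal (dist (g 0) (g s) + dist (g s) (g s') + dist (g s') (g 1)) \<le> path_length g"
proof -
  define t :: "nat \<Rightarrow> real" where
    "t i = (if i = 0 then 0 else if i = 1 then s else if i = 2 then s' else 1)" for i
  have "(\<Sum>i<3. ennreal (dist (g (t i)) (g (t (Suc i))))) \<le> path_length g"
    using assms by (intro chain_le_path_length) (auto simp: t_def mono_def)
  then show ?thesis by (simp add: numeral_3_eq_3 t_def ennreal_plus add.assoc)
qed

lemma sum_lessThan_add:
  fixes f :: "nat \<Rightarrow> 'a::comm_monoid_add"
  shows "(\<Sum>i<n + k. f i) = (\<Sum>i<n. f i) + (\<Sum>i<k. f (n + i))"
  by (induction k) (simp_all add: add.assoc)

text \<open>For \<open>\<le>\<close>, any chain can be cut at \<open>c\<close> by the triangle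
  inequality. For \<open>\<ge>\<close>, a chain of each half can be concatenated to a chain of
  \<open>g\<close>, and the two suprema are taken one after the other.\<close>

lemma path_length_split:
  assumes c: "c \<in> {0..1}"
  shows "path_length g = path_length (subpath 0 c g) + path_length (subpath c 1 g)"
proof (rule antisym)
  show "path_length g \<le> path_length (subpath 0 c g) + path_length (subpath c 1 g)"
  proof (rule path_length_least)
    fix n :: nat and t :: "nat \<Rightarrow> real" assume t: "mono t" "range t \<subseteq> {0..1}"
    \<comment> \<open>Clamping the chain at \<open>c\<close> from either side yields a chain of each
      half; only a link that crosses \<open>c\<close> is really split.\<close>
    define l r where "l i = min (t i) c" and "r i = max (t i) c" for i
    have *: "dist (g (t i)) (g (t (Suc i))) \<le>
        dist (g (l i)) (g (l (Suc i))) + dist (g (r i)) (g (r (Suc i)))" for i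
      using monoD[OF t(1), of i "Suc i"]
      by (auto simp: l_def r_def min_def max_def dist_triangle)
    have "(\<Sum>i<n. ennreal (dist (g (t i)) (g (t (Suc i))))) \<le>
        (\<Sum>i<n. ennreal (dist (g (l i)) (g (l (Suc i)))) + ennreal (dist (g (r i)) (g (r (Suc i)))))"
      by (intro sum_mono) (simp add: * flip: ennreal_plus)
    also have "\<dots> = (\<Sum>i<n. ennreal (dist (g (l i)) (g (l (Suc i)))))
        + (\<Sum>i<n. ennreal (dist (g (r i)) (g (r (Suc i)))))"
      by (rule sum.distrib)
    also have "\<dots> \<le> path_length (subpath 0 c g) + path_length (subpath c 1 g)"
    proof (intro add_mono subchain_le_path_length)
      show "mono l" "mono r" using t(1)
        unfolding mono_def l_def r_def min_def max_def by (auto, (meson order_trans linear)+)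
      show "range l \<subseteq> {0..c}" "range r \<subseteq> {c..1}" using t(2) c
        by (auto simp: l_def r_def image_subset_iff)
    qed
    finally show "(\<Sum>i<n. ennreal (dist (g (t i)) (g (t (Suc i)))))
      \<le> path_length (subpath 0 c g) + path_length (subpath c 1 g)" .
  qed
next
  let ?I = "{(n::nat, t::nat \<Rightarrow> real). mono t \<and> range t \<subseteq> {0..1}}"
  have ne: "?I \<noteq> {}" by (auto intro!: exI[of _ "\<lambda>_. 0"] simp: mono_def)
  define S where "S h = (\<lambda>(n::nat, t::nat \<Rightarrow> real).
      \<Sum>i<n. ennreal (dist (h (t i)) (h (t (Suc i)))))" for h :: "real \<Rightarrow> 'a"
  have PL: "path_length h = (SUP x\<in>?I. S h x)" for h :: "real \<Rightarrow> 'a"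
    by (simp add: path_length_def S_def)
  have main: "S (subpath 0 c g) x + S (subpath c 1 g) y \<le> path_length g"
    if x: "x \<in> ?I" and y: "y \<in> ?I" for x y
  proof -
    obtain n s m s' where xy: "x = (n, s)" "y = (m, s')" by (metis surj_pair)
    have s: "mono s" "\<And>i. 0 \<le> s i \<and> s i \<le> 1" and s': "mono s'" "\<And>i. 0 \<le> s' i \<and> s' i \<le> 1"
      using x y xy by (simp_all add: image_subset_iff)
    \<comment> \<open>The first chain, scaled to \<open>{0..c}\<close>, occupies the indices up to
      \<open>n\<close>; the second, scaled to \<open>{c..1}\<close>, starts at \<open>Suc n\<close>.
      The link between them is extra, hence \<open>n + Suc m\<close> links; its nonnegative
      contribution is dropped afterwards.\<close>
    define t where "t i = (if i \<le> n then c * s i else (1 - c) * s' (i - Suc n) + c)" for i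
    have lo: "0 \<le> c * s i \<and> c * s i \<le> c" for i
      using s(2)[of i] c by (simp add: mult_left_le)
    have hi: "c \<le> (1 - c) * s' i + c \<and> (1 - c) * s' i + c \<le> 1" for i
      using s'(2)[of i] c mult_left_le[of "s' i" "1 - c"] by simp
    have "mono t"
    proof (rule monoI)
      fix i j :: nat assume "i \<le> j"
      then have "s i \<le> s j" "s' (i - Suc n) \<le> s' (j - Suc n)"
        using s(1) s'(1) by (auto simp: mono_def)
      then show "t i \<le> t j"
        using lo[of i] hi[of "j - Suc n"] c \<open>i \<le> j\<close>
        by (auto simp: t_def intro: mult_left_mono order_trans)
    qed
    moreover have "range t \<subseteq> {0..1}"
    proof -
      have "t i \<in> {0..1}" for i
        using lo[of i] hi[of "i - Suc n"] c by (auto simp: t_def)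
      then show ?thesis by auto
    qed
    ultimately have "(\<Sum>i<n + Suc m. ennreal (dist (g (t i)) (g (t (Suc i))))) \<le> path_length g"
      by (rule chain_le_path_length)
    then have le: "(\<Sum>i<n. ennreal (dist (g (t i)) (g (t (Suc i))))) +
        (\<Sum>i<Suc m. ennreal (dist (g (t (n + i))) (g (t (Suc (n + i)))))) \<le> path_length g"
      unfolding sum_lessThan_add .
    have 1: "S (subpath 0 c g) x = (\<Sum>i<n. ennreal (dist (g (t i)) (g (t (Suc i)))))"
      unfolding S_def xy prod.case by (intro sum.cong) (simp_all add: t_def subpath_def)
    have "S (subpath c 1 g) y = (\<Sum>i<m. ennreal (dist (g (t (n + Suc i))) (g (t (Suc (n + Suc i))))))"
      unfolding S_def xy prod.case by (intro sum.cong) (simp_all add: t_def subpath_def)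
    also have "\<dots> \<le> (\<Sum>i<Suc m. ennreal (dist (g (t (n + i))) (g (t (Suc (n + i))))))"
      unfolding sum.lessThan_Suc_shift by (rule add_increasing) simp_all
    finally show ?thesis
      unfolding 1 by (intro order_trans[OF add_left_mono le])
  qed
  have "path_length (subpath 0 c g) + path_length (subpath c 1 g)
      = path_length (subpath c 1 g) + (SUP x\<in>?I. S (subpath 0 c g) x)"
    by (simp add: PL add.commute)
  also have "\<dots> = (SUP x\<in>?I. path_length (subpath c 1 g) + S (subpath 0 c g) x)"
    by (rule ennreal_SUP_add_right[OF ne])
  also have "\<dots> \<le> path_length g"
  proof (rule SUP_least)
    fix x assume x: "x \<in> ?I"
    have "path_length (subpath c 1 g) + S (subpath 0 c g) x
        = (SUP y\<in>?I. S (subpath 0 c g) x + S (subpath c 1 g) y)"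
      unfolding PL[of "subpath c 1 g"] by (subst ennreal_SUP_add_right[OF ne, symmetric]) (simp add: add.commute)
    also have "\<dots> \<le> path_length g" using main x by (intro SUP_least) auto
    finally show "path_length (subpath c 1 g) + S (subpath 0 c g) x \<le> path_length g" .
  qed
  finally show "path_length (subpath 0 c g) + path_length (subpath c 1 g) \<le> path_length g" .
qed

section \<open>Semicontinuity of arc length and bisection of a path\<close>

text \<open>Lower semicontinuity: every chain sum depends continuously on the moving endpoint, so a
  superlevel set of the supremum is a union of relatively open sets.\<close>

lemma openin_path_length_subpath_greater:
  assumes g: "path g"
  shows "openin (top_of_set {0..1}) {t \<in> {0..1}. y < path_length (subpath 0 t g)}"
    and "openin (top_of_set {0..1}) {t \<in> {0..1}. y < path_length (subpath t 1 g)}"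
proof -
  have gen: "openin (top_of_set {0..1}) {t \<in> {0..1}. y < path_length (subpath (a t) (b t) g)}"
    if a: "continuous_on {0..1} a" "a ` {0..1} \<subseteq> {0..1}" and b: "continuous_on {0..1} b" "b ` {0..1} \<subseteq> {0..1}"
    for a b :: "real \<Rightarrow> real"
  proof -
    define S where "S = (\<lambda>(n::nat, s::nat \<Rightarrow> real) t.
      \<Sum>i<n. ennreal (dist (subpath (a t) (b t) g (s i)) (subpath (a t) (b t) g (s (Suc i)))))"
    let ?I = "{(n::nat, t::nat \<Rightarrow> real). mono t \<and> range t \<subseteq> {0..1}}"
    have "{t \<in> {0..1}. y < path_length (subpath (a t) (b t) g)} =
      (\<Union>x\<in>?I. {t \<in> {0..1}. y < S x t})"
      unfolding path_length_def S_def by (fastforce simp: less_SUP_iff)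
    moreover have "openin (top_of_set {0..1}) {t \<in> {0..1}. y < S x t}" if "x \<in> ?I" for x
    proof -
      obtain n s where x: "x = (n, s)" by (metis surj_pair)
      have s: "0 \<le> s i" "s i \<le> 1" for i using that x by (simp_all add: image_subset_iff)
      have cg: "continuous_on {0..1} (\<lambda>t. subpath (a t) (b t) g (s i))" for i
        unfolding subpath_def
      proof (rule continuous_on_compose2[of "{0..1}" g])
        show "continuous_on {0..1} g" using g by (simp add: path_def)
        show "continuous_on {0..1} (\<lambda>t. (b t - a t) * s i + a t)"
          by (intro continuous_intros a b)
        show "(\<lambda>t. (b t - a t) * s i + a t) ` {0..1} \<subseteq> {0..1}"
        proof (clarify)
          fix t :: real assume "t \<in> {0..1}"
          then have "a t \<in> {0..1}" "b t \<in> {0..1}"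
            using a(2) b(2) by (simp_all add: image_subset_iff)
          then have "(1 - s i) *\<^sub>R a t + s i *\<^sub>R b t \<in> {0..1}"
            using s[of i] by (intro convexD_alt) auto
          then show "(b t - a t) * s i + a t \<in> {0..1}" by (simp add: algebra_simps)
        qed
      qed
      have "S x = (\<lambda>t. ennreal (\<Sum>i<n. dist (subpath (a t) (b t) g (s i)) (subpath (a t) (b t) g (s (Suc i)))))"
        by (simp add: S_def x sum_ennreal)
      moreover have "continuous_on {0..1} \<dots>"
        by (intro continuous_on_ennreal continuous_on_sum continuous_on_dist cg)
      ultimately have "continuous_on {0..1} (S x)" by simp
      from continuous_openin_preimage_gen[OF this open_greaterThan[of y]]
      show ?thesis by (simp add: vimage_def Int_def)
    qed
    ultimately show ?thesis
      by (simp only:) (rule openin_Union, blast)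
  qed
  show "openin (top_of_set {0..1}) {t \<in> {0..1}. y < path_length (subpath 0 t g)}"
    by (rule gen) (auto simp: continuous_on_id)
  show "openin (top_of_set {0..1}) {t \<in> {0..1}. y < path_length (subpath t 1 g)}"
    by (rule gen) (auto simp: continuous_on_id)
qed

text \<open>The lengths \<open>F\<close> and \<open>G\<close> of the two parts have constant sum.
  Without a bisecting parameter, the sets where \<open>F\<close> or \<open>G\<close> exceeds half of
  the length would be disjoint, nonempty, relatively open and cover the connected unit
  interval.\<close>

lemma path_bisection:
  assumes g: "path g" and fin: "path_length g < \<infinity>" and pos: "0 < path_length g"
  obtains t where "t \<in> {0<..<1}" "path_length (subpath 0 t g) = path_length g / 2"
    "path_length (subpath t 1 g) = path_length g / 2"
proof -
  define L where "L = path_length g"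
  define F where "F t = path_length (subpath 0 t g)" for t
  define G where "G t = path_length (subpath t 1 g)" for t
  have FG: "F t + G t = L" if "t \<in> {0..1}" for t
    using path_length_split[OF that, of g] by (simp add: F_def G_def L_def)
  obtain r where r: "0 < r" "L = ennreal r"
    using fin pos by (cases L) (auto simp: L_def)
  then have L2: "L / 2 = ennreal (r / 2)"
    using divide_ennreal[of r 2] by simp
  have half: "L / 2 + L / 2 = L"
    using r unfolding L2 by (simp flip: ennreal_plus)
  have half_lt: "L / 2 < L"
    using r unfolding L2 by (simp add: ennreal_less_iff)
  have F0: "F 0 = 0" "G 1 = 0"
    unfolding F_def G_def by (rule path_length_constant[where c = "g 0"]
      path_length_constant[where c = "g 1"], simp add: subpath_def)+
  have "\<exists>t\<in>{0..1}. F t = L / 2 \<and> G t = L / 2"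
  proof (rule ccontr)
    assume no: "\<not> ?thesis"
    let ?U = "{t \<in> {0..1}. L / 2 < F t}" and ?V = "{t \<in> {0..1}. L / 2 < G t}"
    have cover: "{0..1} \<subseteq> ?U \<union> ?V"
    proof
      fix t :: real assume t: "t \<in> {0..1}"
      show "t \<in> ?U \<union> ?V"
      proof (rule ccontr)
        assume "t \<notin> ?U \<union> ?V"
        then have le: "F t \<le> L / 2" "G t \<le> L / 2" using t by auto
\<comment> \<open>Two values that are at most \<open>L / 2\<close> and add up to \<open>L\<close>
  must both equal \<open>L / 2\<close>; addition in \<open>ennreal\<close> cancels only for finite
  terms.\<close>
have "L / 2 < \<infinity>" by (simp add: L2)
        then have "F t = L / 2 \<and> G t = L / 2"
          using le FG[OF t] half
          by (metis add.commute antisym_conv2 ennreal_add_left_cancel_less less_le_not_le)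
        then show False using no t by auto
      qed
    qed
    moreover have "?U \<inter> ?V = {}"
    proof -
      have "\<not> (L / 2 < F t \<and> L / 2 < G t)" if "t \<in> {0..1}" for t
        using FG[OF that] half add_strict_mono by fastforce
      then show ?thesis by auto
    qed
    moreover have "1 \<in> ?U" "0 \<in> ?V" using FG[of 0] FG[of 1] F0 half_lt by auto
    ultimately show False
      using connected_Icc[of "0::real" 1] openin_path_length_subpath_greater[OF g, of "L / 2"]
      unfolding connected_openin F_def[symmetric] G_def[symmetric] by blast
  qed
  then obtain t where t: "t \<in> {0..1}" "F t = L / 2" "G t = L / 2" by auto
  have "L / 2 \<noteq> 0" using pos by (simp add: L_def)
  then have "t \<noteq> 0" "t \<noteq> 1" using t F0 by auto
  then show ?thesis using that[of t] t by (simp add: F_def G_def L_def)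
qed

section \<open>Upper bounds for length from Lipschitz paths\<close>

text \<open>Encodes that \<open>S\<close> contains a path from \<open>x\<close> to \<open>y\<close>
  of length at most \<open>L\<close>, run through at speed at most 1. In this form the bound passes
  through concatenations and 1-Lipschitz maps without computing any
  \<open>path_length\<close>.\<close>

definition lip_joinable :: "'a::metric_space set \<Rightarrow> real \<Rightarrow> 'a \<Rightarrow> 'a \<Rightarrow> bool" where
  "lip_joinable S L x y \<longleftrightarrow> 0 \<le> L \<and>
     (\<exists>f. 1-lipschitz_on {0..L} f \<and> f 0 = x \<and> f L = y \<and> f ` {0..L} \<subseteq> S)"

lemma lip_joinable_segment:
  fixes x y :: "'a::real_normed_vector"
  assumes "closed_segment x y \<subseteq> S"
  shows "lip_joinable S (dist x y) x y"
proof (cases "x = y")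
  case True
  then show ?thesis using assms
    unfolding lip_joinable_def by (auto intro!: exI[of _ "\<lambda>_. x"] lipschitz_onI)
next
  case False
  define d where "d = dist x y"
  have d: "d > 0" "d = norm (y - x)" using False by (auto simp: d_def dist_norm norm_minus_commute)
  define f where "f s = x + (s / d) *\<^sub>R (y - x)" for s
  have "1-lipschitz_on {0..d} f"
  proof (rule lipschitz_onI)
    fix s s' :: real
    have "f s - f s' = ((s - s') / d) *\<^sub>R (y - x)"
      by (simp add: f_def algebra_simps diff_divide_distrib)
    then show "dist (f s) (f s') \<le> 1 * dist s s'"
      using d by (simp add: dist_norm)
  qed simp
  moreover have "f ` {0..d} \<subseteq> S"
  proof clarify
    fix s assume "s \<in> {0..d}"
    then have "f s \<in> closed_segment x y"
      using d(1) unfolding in_segment f_def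
      by (intro exI[of _ "s / d"]) (auto simp: algebra_simps)
    then show "f s \<in> S" using assms by auto
  qed
  ultimately show ?thesis using d(1) unfolding lip_joinable_def d_def[symmetric]
    by (auto intro!: exI[of _ f] simp: f_def)
qed

lemma lip_joinable_trans:
  assumes "lip_joinable S L x y" "lip_joinable S M y z"
  shows "lip_joinable S (L + M) x z"
proof -
  obtain f g where f: "1-lipschitz_on {0..L} f" "f 0 = x" "f L = y" "f ` {0..L} \<subseteq> S"
    and g: "1-lipschitz_on {0..M} g" "g 0 = y" "g M = z" "g ` {0..M} \<subseteq> S" and LM: "0 \<le> L" "0 \<le> M"
    using assms unfolding lip_joinable_def by auto
  have "1-lipschitz_on {L..L + M} (\<lambda>s. g (s - L))"
  proof (rule lipschitz_onI)
    fix s s' assume "s \<in> {L..L + M}" "s' \<in> {L..L + M}"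
    then have "dist (g (s - L)) (g (s' - L)) \<le> 1 * dist (s - L) (s' - L)"
      by (intro lipschitz_onD[OF g(1)]) auto
    then show "dist (g (s - L)) (g (s' - L)) \<le> 1 * dist s s'" by (simp add: dist_real_def)
  qed simp
  then have "1-lipschitz_on {0..L + M} (\<lambda>s. if s \<le> L then f s else g (s - L))"
    using f g by (intro lipschitz_on_concat) auto
  then show ?thesis
    unfolding lip_joinable_def using f g LM
    by (intro conjI exI[of _ "\<lambda>s. if s \<le> L then f s else g (s - L)"]) auto
qed

lemma lip_joinable_image:
  assumes "lip_joinable S L x y" "1-lipschitz_on S h" "h ` S \<subseteq> T"
  shows "lip_joinable T L (h x) (h y)"
proof -
  obtain f where f: "1-lipschitz_on {0..L} f" "f 0 = x" "f L = y" "f ` {0..L} \<subseteq> S" "0 \<le> L"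
    using assms unfolding lip_joinable_def by auto
  have "1-lipschitz_on {0..L} (\<lambda>s. h (f s))"
    using lipschitz_on_compose2[OF f(1) lipschitz_on_subset[OF assms(2) f(4)]] by simp
  then show ?thesis
    unfolding lip_joinable_def using f assms(3)
    by (intro conjI exI[of _ "\<lambda>s. h (f s)"]) auto
qed

text \<open>A Lipschitz path inside an arc that joins its endpoints passes the points of any inscribed
  chain at increasing first hitting times.\<close>
lemma path_length_arc_le:
  fixes h :: "real \<Rightarrow> 'a::metric_space"
  assumes h: "arc h" and f: "lip_joinable (path_image h) L (h 0) (h 1)"
  shows "path_length h \<le> ennreal L"
proof -
  obtain f where f: "1-lipschitz_on {0..L} f" "f 0 = h 0" "f L = h 1" "f ` {0..L} \<subseteq> path_image h"
      and L: "0 \<le> L"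
    using f unfolding lip_joinable_def by auto
  have inj: "inj_on h {0..1}" and ch: "continuous_on {0..1} h"
    using h by (auto simp: arc_def path_def)
  define k where "k = inv_into {0..1} h"
  have kh: "k (h s) = s" if "s \<in> {0..1}" for s
    using inj that by (simp add: k_def)
  have hk: "h (k z) = z" "k z \<in> {0..1}" if "z \<in> path_image h" for z
    using that unfolding k_def path_image_def by (rule f_inv_into_f, rule inv_into_into)
  have ck: "continuous_on (path_image h) k"
    unfolding path_image_def by (rule continuous_on_inv[OF ch]) (auto simp: kh)
  \<comment> \<open>\<open>\<phi> s\<close> is the parameter on the arc \<open>h\<close> of the
    position of \<open>f\<close> at time \<open>s\<close>.\<close>
  define \<phi> where "\<phi> s = k (f s)" for s
  have c\<phi>: "continuous_on {0..L} \<phi>"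
    unfolding \<phi>_def
    by (rule continuous_on_compose2[OF ck lipschitz_on_continuous_on[OF f(1)] f(4)])
  have \<phi>0: "\<phi> 0 = 0" and \<phi>L: "\<phi> L = 1" using f kh by (auto simp: \<phi>_def)
  have f\<phi>: "f s = h (\<phi> s)" if "s \<in> {0..L}" for s
    using hk(1)[of "f s"] f(4) that by (simp add: \<phi>_def image_subset_iff)
  define \<sigma> where "\<sigma> \<theta> = Inf {s \<in> {0..L}. \<phi> s = \<theta>}" for \<theta>
  have \<sigma>: "\<sigma> \<theta> \<in> {0..L}" "\<phi> (\<sigma> \<theta>) = \<theta>" if "\<theta> \<in> {0..1}" for \<theta>
  proof -
    have "\<exists>s\<ge>0. s \<le> L \<and> \<phi> s = \<theta>"
      using that L c\<phi> \<phi>0 \<phi>L by (intro IVT') auto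
    then have ne: "{s \<in> {0..L}. \<phi> s = \<theta>} \<noteq> {}" by auto
    have "closed {s \<in> {0..L}. \<phi> s = \<theta>}"
      using continuous_closed_preimage_constant[OF c\<phi> closed_atLeastAtMost] .
    then have "\<sigma> \<theta> \<in> {s \<in> {0..L}. \<phi> s = \<theta>}"
      unfolding \<sigma>_def using ne by (intro closed_contains_Inf) (auto intro: bdd_belowI[of _ 0])
    then show "\<sigma> \<theta> \<in> {0..L}" "\<phi> (\<sigma> \<theta>) = \<theta>" by auto
  qed
  have \<sigma>_mono: "\<sigma> \<theta> \<le> \<sigma> \<theta>'" if "\<theta> \<in> {0..1}" "\<theta>' \<in> {0..1}" "\<theta> \<le> \<theta>'" for \<theta> \<theta>'
  proof -
    \<comment> \<open>Starting at parameter 0, \<open>\<phi>\<close> has to pass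
      \<open>\<theta>\<close> before it reaches \<open>\<theta>'\<close>.\<close>
    have "\<exists>s\<ge>0. s \<le> \<sigma> \<theta>' \<and> \<phi> s = \<theta>"
      using that \<sigma>[of \<theta>'] \<phi>0 by (intro IVT') (auto intro: continuous_on_subset[OF c\<phi>])
    then obtain s where s: "0 \<le> s" "s \<le> \<sigma> \<theta>'" "\<phi> s = \<theta>" by auto
    have "\<sigma> \<theta> \<le> s" unfolding \<sigma>_def
      using s \<sigma>[of \<theta>'] that by (intro cInf_lower) (auto intro: bdd_belowI[of _ 0])
    then show ?thesis using s by simp
  qed
  show ?thesis
  proof (rule path_length_least)
    fix n :: nat and t :: "nat \<Rightarrow> real" assume t: "mono t" "range t \<subseteq> {0..1}"
    have t01: "t i \<in> {0..1}" for i using t(2) by (simp add: image_subset_iff)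
    have le: "dist (h (t i)) (h (t (Suc i))) \<le> \<sigma> (t (Suc i)) - \<sigma> (t i)" for i
    proof -
      have "dist (f (\<sigma> (t i))) (f (\<sigma> (t (Suc i)))) \<le> 1 * dist (\<sigma> (t i)) (\<sigma> (t (Suc i)))"
        using \<sigma>[OF t01] by (intro lipschitz_onD[OF f(1)]) auto
      moreover have "\<sigma> (t i) \<le> \<sigma> (t (Suc i))"
        using t01 monoD[OF t(1), of i "Suc i"] by (intro \<sigma>_mono) auto
      ultimately show ?thesis
        using \<sigma>[OF t01] by (simp add: f\<phi> dist_real_def)
    qed
    have "(\<Sum>i<n. dist (h (t i)) (h (t (Suc i)))) \<le> (\<Sum>i<n. \<sigma> (t (Suc i)) - \<sigma> (t i))"
      by (intro sum_mono le)
    also have "\<dots> = \<sigma> (t n) - \<sigma> (t 0)" by (rule sum_lessThan_telescope)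
    also have "\<dots> \<le> L" using \<sigma>(1)[OF t01, of n] \<sigma>(1)[OF t01, of 0] by auto
    finally show "(\<Sum>i<n. ennreal (dist (h (t i)) (h (t (Suc i))))) \<le> ennreal L"
      by (simp add: sum_ennreal ennreal_leI)
  qed
qed

subsection \<open>Arcs of the boundary of a convex body\<close>

text \<open>Otherwise \<open>p\<close> would lie strictly between an interior point and the point
  \<open>x\<close> of \<open>K\<close>, and would be interior itself.\<close>

lemma notin_interior_halfline:
  fixes K :: "'a::euclidean_space set"
  assumes "convex K" "p \<in> frontier K" "x \<in> K" "0 \<le> s"
  shows "p + s *\<^sub>R (p - x) \<notin> interior K"
proof
  assume int: "p + s *\<^sub>R (p - x) \<in> interior K"
  have p: "p \<notin> interior K" using assms(2) by (simp add: frontier_def)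
  have "s > 0" "p \<noteq> x" using int p assms(4) by (auto simp: le_less)
  \<comment> \<open>The weight of \<open>x\<close> when \<open>p\<close> is written as a convex
    combination of \<open>x\<close> and the point beyond \<open>p\<close>.\<close>
  define k where "k = s / (1 + s)"
  have k: "0 < k" "k < 1" "(1 - k) * (1 + s) = 1" "(1 - k) * s = k"
    using \<open>s > 0\<close> by (simp_all add: k_def field_simps)
  have "(1 - k) *\<^sub>R (p + s *\<^sub>R (p - x)) + k *\<^sub>R x
      = ((1 - k) * (1 + s)) *\<^sub>R p - ((1 - k) * s) *\<^sub>R x + k *\<^sub>R x"
    by (simp only: scaleR_add_right scaleR_diff_right scaleR_add_left scaleR_scaleR distrib_left) simp
  then have "p = (1 - k) *\<^sub>R (p + s *\<^sub>R (p - x)) + k *\<^sub>R x" by (simp only: k) simp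
  moreover have "p + s *\<^sub>R (p - x) \<noteq> x"
  proof
    assume "p + s *\<^sub>R (p - x) = x"
    then have "(1 + s) *\<^sub>R (p - x) = 0" by (simp add: algebra_simps)
    then show False using \<open>p \<noteq> x\<close> assms(4) by simp
  qed
  ultimately have "p \<in> open_segment (p + s *\<^sub>R (p - x)) x"
    unfolding in_segment using k by (intro conjI exI[of _ k]) auto
  then show False
    using in_interior_closure_convex_segment[OF assms(1) int, of x] assms(3) closure_subset p by blast
qed

text \<open>The point of \<open>K\<close> farthest along the ray exists by compactness; at an
  interior point the ray could be followed further inside \<open>K\<close>.\<close>

lemma exit_point_frontier:
  fixes K :: "'a::euclidean_space set"
  assumes K: "compact K" and x: "x \<in> K" and d: "d \<noteq> 0"
  obtains s where "0 \<le> s" "x + s *\<^sub>R d \<in> frontier K"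
proof -
  let ?T = "{y \<in> K. \<exists>s\<ge>0. y = x + s *\<^sub>R d}"
  have "closed ((\<lambda>s. x + s *\<^sub>R d) ` {0..})"
  proof -
    have "linear (\<lambda>s. s *\<^sub>R d)" by (simp add: linear_iff scaleR_left_distrib)
    moreover have "inj (\<lambda>s. s *\<^sub>R d)" using d by (intro injI) (metis scaleR_cancel_right)
    ultimately have "closed ((\<lambda>s. s *\<^sub>R d) ` {0..})"
      by (rule closed_injective_linear_image[OF closed_atLeast])
    then have "closed ((\<lambda>y. x + y) ` (\<lambda>s. s *\<^sub>R d) ` {0..})"
      by (rule closed_translation)
    then show ?thesis by (simp add: image_image)
  qed
  then have "compact (K \<inter> (\<lambda>s. x + s *\<^sub>R d) ` {0..})" by (rule compact_Int_closed[OF K])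
  moreover have "x \<in> K \<inter> (\<lambda>s. x + s *\<^sub>R d) ` {0..}" using x by (auto intro: image_eqI[of _ _ 0])
  ultimately obtain z where z: "z \<in> K \<inter> (\<lambda>s. x + s *\<^sub>R d) ` {0..}"
    and max: "\<And>y. y \<in> K \<inter> (\<lambda>s. x + s *\<^sub>R d) ` {0..} \<Longrightarrow> d \<bullet> y \<le> d \<bullet> z"
    using continuous_attains_sup[OF _ _ continuous_on_inner[OF continuous_on_const continuous_on_id]]
    by (metis (lifting) empty_iff)
  from z obtain s where s: "0 \<le> s" "z = x + s *\<^sub>R d" by auto
  have "z \<notin> interior K"
  proof
    assume "z \<in> interior K"
    then obtain e where e: "e > 0" "cball z e \<subseteq> K" by (meson mem_interior_cball)
    let ?y = "z + (e / norm d) *\<^sub>R d"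
    have "?y \<in> K" using e d by (intro subsetD[OF e(2)]) (auto simp: dist_norm)
    moreover have "?y = x + (s + e / norm d) *\<^sub>R d" by (simp add: s algebra_simps)
    ultimately have "d \<bullet> ?y \<le> d \<bullet> z" using s e by (intro max) auto
    moreover have "0 < (e / norm d) * (d \<bullet> d)" using e d by simp
    ultimately show False by (simp only: inner_add_right inner_scaleR_right)
  qed
  then have "z \<in> frontier K" using z closure_subset by (auto simp: frontier_def)
  then show ?thesis using that s by auto
qed

text \<open>The nearest-point projection onto \<open>K \<inter> H\<close> is 1-Lipschitz, fixes
  \<open>p\<close> and \<open>q\<close>, and takes points of \<open>H\<close> outside the interior
  of \<open>K\<close> to the frontier of \<open>K\<close>. It therefore pushes a detour onto the
  boundary arc.\<close>

lemma lip_joinable_frontier_Int: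
  fixes K H :: "'a::euclidean_space set"
  assumes K: "convex K" "closed K" and H: "convex H" "closed H"
    and pq: "p \<in> frontier K \<inter> H" "q \<in> frontier K \<inter> H"
    and L: "lip_joinable (H - interior K) L p q"
  shows "lip_joinable (frontier K \<inter> H) L p q"
proof -
  let ?S = "K \<inter> H"
  have S: "convex ?S" "closed ?S" using assms by (auto simp: convex_Int)
  have fr: "frontier K = K - interior K" using K by (simp add: frontier_def)
  have ne: "?S \<noteq> {}" using pq by (auto simp: fr)
  have img: "closest_point ?S z \<in> frontier K \<inter> H" if z: "z \<in> H - interior K" for z
  proof -
    define w where "w = closest_point ?S z"
    have w: "w \<in> ?S" unfolding w_def using closest_point_in_set[OF S(2) ne] .
    have "w \<notin> interior K"
    proof
      assume wi: "w \<in> interior K"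
      then obtain e where e: "e > 0" "cball w e \<subseteq> K" by (meson mem_interior_cball)
      have d: "norm (z - w) > 0" using z wi by auto
      \<comment> \<open>Moving \<open>w\<close> towards \<open>z\<close> by the fraction
        \<open>t\<close> stays in \<open>H\<close> by convexity and in \<open>K\<close> because the
        step is at most \<open>e\<close>; the result is nearer to \<open>z\<close> than the nearest
        point.\<close>
      define t where "t = min 1 (e / norm (z - w))"
      have t: "0 < t" "t \<le> 1" "t * norm (z - w) \<le> e" using e d by (auto simp: t_def min_def field_simps)
      let ?y = "w + t *\<^sub>R (z - w)"
      have "?y \<in> K" using t by (intro subsetD[OF e(2)]) (auto simp: dist_norm)
      moreover have "?y \<in> H"
        using convexD_alt[OF H(1), of w z t] w z t by (auto simp: algebra_simps)
      ultimately have "dist z w \<le> dist z ?y"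
        unfolding w_def using closest_point_le[OF S(2)] by blast
      moreover have "z - ?y = (1 - t) *\<^sub>R (z - w)" by (simp add: algebra_simps)
      then have "dist z ?y = (1 - t) * dist z w" using t by (simp add: dist_norm)
      ultimately have "dist z w \<le> (1 - t) * dist z w" by (simp only:)
      then have "t * dist z w \<le> 0" by (simp add: left_diff_distrib)
      then show False using t d by (simp add: mult_le_0_iff)
    qed
    then show ?thesis using w by (auto simp: w_def fr)
  qed
  have "1-lipschitz_on (H - interior K) (closest_point ?S)"
    using closest_point_lipschitz[OF S ne] by (intro lipschitz_onI) simp_all
  then have "lip_joinable (frontier K \<inter> H) L (closest_point ?S p) (closest_point ?S q)"
    by (rule lip_joinable_image[OF L]) (use img in blast)
  moreover have "closest_point ?S p = p" "closest_point ?S q = q"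
    using pq by (auto intro!: closest_point_self simp: fr)
  ultimately show ?thesis by simp
qed

text \<open>The segments from \<open>p\<close> to \<open>v\<close> and from \<open>q\<close> to \<open>u\<close> are the diagonals of a trapezoid; the
  two legs are bounded through the point where the diagonals meet.\<close>
lemma trapezoid_diagonals_ge_legs:
  fixes p q u v :: "'a::euclidean_space"
  assumes c: "0 < c" and uv: "u - v = c *\<^sub>R (p - q)"
  shows "dist p u + dist q v \<le> dist p v + dist q u"
proof -
  \<comment> \<open>The parallel sides \<open>uv\<close> and \<open>pq\<close> have ratio
    \<open>c\<close> to 1 and the diagonals cut each other in this ratio, at the fraction
    \<open>k\<close> of the way from \<open>u\<close> to \<open>q\<close> and from \<open>v\<close>
    to \<open>p\<close>.\<close>
  define k where "k = c / (1 + c)"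
  have k: "0 \<le> k" "k \<le> 1" "(1 - k) * c = k" using c by (simp_all add: k_def field_simps)
  define x where "x = (1 - k) *\<^sub>R u + k *\<^sub>R q"
  have u: "u = v + c *\<^sub>R (p - q)" using uv by (simp add: algebra_simps)
  have x: "x \<in> closed_segment u q" using k by (auto simp: x_def in_segment)
  have "x = (1 - k) *\<^sub>R v + ((1 - k) * c) *\<^sub>R (p - q) + k *\<^sub>R q"
    by (simp add: x_def u scaleR_add_right)
  then have "x = (1 - k) *\<^sub>R v + k *\<^sub>R p" by (simp add: k scaleR_diff_right)
  then have y: "x \<in> closed_segment v p" using k by (auto simp: in_segment)
  have "dist u q = dist u x + dist x q" "dist v p = dist v x + dist x p"
    using x y by (simp_all add: between flip: between_mem_segment)
  moreover have "dist p u \<le> dist x p + dist u x" "dist q v \<le> dist x q + dist v x"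
    by metric+
  ultimately show ?thesis by (simp add: dist_commute)
qed

lemma arc_length_closed_segment_le:
  fixes h :: "real \<Rightarrow> 'a::real_normed_vector"
  assumes "arc h" "closed_segment (h 0) (h 1) \<subseteq> path_image h"
  shows "path_length h \<le> ennreal (dist (h 0) (h 1))"
  using assms by (intro path_length_arc_le lip_joinable_segment)

text \<open>A point off the segment would give a two-link inscribed chain longer than the distance
  of the ends.\<close>

lemma path_image_subset_closed_segment:
  fixes h :: "real \<Rightarrow> 'a::euclidean_space"
  assumes "path_length h \<le> ennreal (dist (h 0) (h 1))"
  shows "path_image h \<subseteq> closed_segment (h 0) (h 1)"
proof
  fix w assume "w \<in> path_image h"
  then obtain s where s: "s \<in> {0..1}" "w = h s" by (auto simp: path_image_def)
  have "ennreal (dist (h 0) (h s) + dist (h s) (h 1)) \<le> ennreal (dist (h 0) (h 1))"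
    using path_length_ge_2[OF s(1), of h] assms by (rule order_trans)
  then have "dist (h 0) (h s) + dist (h s) (h 1) \<le> dist (h 0) (h 1)"
    by (subst (asm) ennreal_le_iff) simp_all
  then have "dist (h 0) (h 1) = dist (h 0) (h s) + dist (h s) (h 1)"
    using dist_triangle[of "h 0" "h 1" "h s"] by linarith
  then show "w \<in> closed_segment (h 0) (h 1)"
    by (simp add: s between flip: between_mem_segment)
qed

text \<open>A single interior point on the segment makes everything between it and either end
  interior.\<close>

lemma open_segment_interior_or_frontier:
  fixes K :: "'a::euclidean_space set"
  assumes K: "convex K" "closed K" and pq: "p \<in> K" "q \<in> K"
  shows "open_segment p q \<subseteq> interior K \<or> open_segment p q \<subseteq> frontier K"
proof (cases "open_segment p q \<inter> interior K = {}")
  case True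
  have "open_segment p q \<subseteq> K"
    using assms by (meson convex_contains_open_segment)
  then show ?thesis using True K(2) by (auto simp: frontier_def)
next
  case False
  then obtain m where m: "m \<in> open_segment p q" "m \<in> interior K" by auto
  have "open_segment m p \<subseteq> interior K" "open_segment m q \<subseteq> interior K"
    using in_interior_closure_convex_segment[OF K(1) m(2)] pq closure_subset by blast+
  moreover have "open_segment p q \<subseteq> open_segment m p \<union> open_segment m q \<union> {m}"
    using m(1) Un_open_segment[OF m(1)] by (auto simp: open_segment_commute)
  ultimately show ?thesis using m(2) by blast
qed

section \<open>The chord of a halving pair and the two sides of its line\<close>

text \<open>Otherwise the chord would be part of the boundary and contained in one of the arcs. That
  arc would have length \<open>dist p q\<close>, hence so would the other, and both would lie in the
  segment, leaving \<open>K\<close> without interior.\<close>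

lemma halving_segment_interior:
  fixes K :: "'a::euclidean_space set"
  assumes dim: "2 \<le> DIM('a)" and K: "convex K" "compact K" "interior K \<noteq> {}"
    and h: "arc h" "h 0 = p" "h 1 = q" and h': "arc h'" "h' 0 = q" "h' 1 = p"
    and un: "path_image h \<union> path_image h' = frontier K"
    and int: "path_image h \<inter> path_image h' = {p, q}"
    and eq: "path_length h = path_length h'"
  shows "open_segment p q \<subseteq> interior K"
proof (rule ccontr)
  assume no: "\<not> ?thesis"
  have cl: "closed K" using K by (simp add: compact_imp_closed)
  have "p \<in> frontier K" "q \<in> frontier K" using un int by auto
  then have "p \<in> K" "q \<in> K" using cl by (auto simp: frontier_def)
  then have "open_segment p q \<subseteq> frontier K"
    using open_segment_interior_or_frontier[OF K(1) cl] no by blast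
  then have sub: "open_segment p q \<subseteq> path_image h \<union> path_image h'" using un by simp
  have disj: "path_image h \<inter> path_image h' \<inter> open_segment p q = {}"
    using int by (auto simp: open_segment_def)
  have clo: "closed (path_image h)" "closed (path_image h')"
    using h h' by (auto simp: arc_imp_path closed_path_image)
  \<comment> \<open>The arcs are closed and meet only in \<open>p\<close> and \<open>q\<close>, so
    the connected open segment cannot be shared between them.\<close>
  have "open_segment p q \<inter> path_image h = {} \<or> open_segment p q \<inter> path_image h' = {}"
    using connected_closedD[OF convex_connected[OF convex_open_segment] disj sub clo] by (auto simp: Int_commute)
  then have "open_segment p q \<subseteq> path_image h' \<or> open_segment p q \<subseteq> path_image h" using sub by blast
  then have "closed_segment p q \<subseteq> path_image h' \<or> closed_segment p q \<subseteq> path_image h"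
    using int unfolding closed_segment_eq_open by blast
  then have "path_length h' \<le> ennreal (dist p q) \<or> path_length h \<le> ennreal (dist p q)"
    using arc_length_closed_segment_le[OF h(1)] arc_length_closed_segment_le[OF h'(1)] h h'
    by (auto simp: closed_segment_commute dist_commute)
  then have "path_length h \<le> ennreal (dist (h 0) (h 1))" "path_length h' \<le> ennreal (dist (h' 0) (h' 1))"
    using eq h h' by (auto simp: dist_commute)
  then have "path_image h \<subseteq> closed_segment p q" "path_image h' \<subseteq> closed_segment p q"
    using path_image_subset_closed_segment[of h] path_image_subset_closed_segment[of h'] h h'
    by (auto simp: closed_segment_commute)
  then have "frontier K \<subseteq> closed_segment p q" using un by blast
  then have "convex hull frontier K \<subseteq> closed_segment p q" by (simp add: hull_minimal)
  then have "K \<subseteq> closed_segment p q" using Krein_Milman_frontier[OF K(1,2)] by simp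
  then have "interior K \<subseteq> {}" using interior_mono interior_closed_segment_ge2[OF dim] by metis
  then show False using K(3) by simp
qed

lemma simple_loop_arcs:
  fixes g :: "real \<Rightarrow> 'a::real_normed_vector"
  assumes g: "simple_path g" "pathfinish g = pathstart g" and t: "t \<in> {0<..<1}"
  shows "g 0 \<noteq> g t" "arc (subpath 0 t g)" "arc (subpath t 1 g)"
    "path_image (subpath 0 t g) \<union> path_image (subpath t 1 g) = path_image g"
    "path_image (subpath 0 t g) \<inter> path_image (subpath t 1 g) = {g 0, g t}"
    "subpath 0 t g 0 = g 0" "subpath 0 t g 1 = g t" "subpath t 1 g 0 = g t" "subpath t 1 g 1 = g 0"
proof -
  have g01: "g 1 = g 0" using g(2) by (simp add: pathstart_def pathfinish_def)
  have inj: "x = y \<or> x = 0 \<and> y = 1 \<or> x = 1 \<and> y = 0"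
    if "x \<in> {0..1}" "y \<in> {0..1}" "g x = g y" for x y
    using g(1) that unfolding simple_path_def loop_free_def by blast
  show ne: "g 0 \<noteq> g t" using inj[of 0 t] t by auto
  show "arc (subpath 0 t g)" using g t ne by (intro arc_simple_path_subpath) auto
  show "arc (subpath t 1 g)" using g t ne g01 by (intro arc_simple_path_subpath) auto
  have im: "path_image (subpath 0 t g) = g ` {0..t}" "path_image (subpath t 1 g) = g ` {t..1}"
    using t by (simp_all add: path_image_subpath)
  have "{0..t} \<union> {t..1} = {0..1}" using t by auto
  then show "path_image (subpath 0 t g) \<union> path_image (subpath t 1 g) = path_image g"
    unfolding im by (simp add: path_image_def flip: image_Un)
  show "path_image (subpath 0 t g) \<inter> path_image (subpath t 1 g) = {g 0, g t}"
  proof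
    show "path_image (subpath 0 t g) \<inter> path_image (subpath t 1 g) \<subseteq> {g 0, g t}"
    proof
      fix z assume "z \<in> path_image (subpath 0 t g) \<inter> path_image (subpath t 1 g)"
      then obtain x y where xy: "x \<in> {0..t}" "y \<in> {t..1}" "z = g x" "z = g y"
        unfolding im by auto
      then have "x = y \<or> x = 0 \<and> y = 1 \<or> x = 1 \<and> y = 0" using t by (intro inj) auto
      then have "x = t \<or> x = 0" using xy t by auto
      then show "z \<in> {g 0, g t}" using xy by auto
    qed
    have "g 0 \<in> g ` {0..t}" "g t \<in> g ` {0..t}" "g t \<in> g ` {t..1}" "g 1 \<in> g ` {t..1}" using t by auto
    then show "{g 0, g t} \<subseteq> path_image (subpath 0 t g) \<inter> path_image (subpath t 1 g)"
      unfolding im by (auto simp: g01)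
  qed
qed (use assms in \<open>auto simp: subpath_def pathstart_def pathfinish_def\<close>)

lemma orthogonal_collinear_real2:
  fixes n d v :: "real^2"
  assumes "n \<noteq> 0" "d \<noteq> 0" "n \<bullet> d = 0" "n \<bullet> v = 0"
  obtains s where "v = s *\<^sub>R d"
proof -
  have n: "n$1 * d$1 + n$2 * d$2 = 0" "n$1 * v$1 + n$2 * v$2 = 0"
    using assms by (simp_all add: inner_vec_def sum_2)
  have "n$1 * (v$1 * d$2 - v$2 * d$1) = 0" "n$2 * (v$1 * d$2 - v$2 * d$1) = 0"
    using n by algebra+
  moreover have "n$1 \<noteq> 0 \<or> n$2 \<noteq> 0" using assms(1) by (auto simp: vec_eq_iff forall_2)
  ultimately have cross: "v$1 * d$2 = v$2 * d$1" by auto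
  have dd: "d \<bullet> d \<noteq> 0" using assms(2) by simp
  have "(d \<bullet> d) * v$1 = (v \<bullet> d) * d$1" "(d \<bullet> d) * v$2 = (v \<bullet> d) * d$2"
    using cross unfolding inner_vec_def sum_2 inner_real_def by algebra+
  then have "v = ((v \<bullet> d) / (d \<bullet> d)) *\<^sub>R d"
    using dd by (auto simp: vec_eq_iff forall_2 field_simps)
  then show ?thesis using that by blast
qed

text \<open>The midpoint \<open>m\<close> of the chord is interior. A frontier point beyond
  \<open>p\<close> or \<open>q\<close> would put that end strictly between itself and
  \<open>m\<close>; one between \<open>p\<close> and \<open>q\<close> would lie on the interior
  chord.\<close>

lemma frontier_on_chord_line:
  fixes K :: "(real^2) set"
  assumes K: "convex K" "closed K" and pq: "p \<in> frontier K" "q \<in> frontier K" "p \<noteq> q"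
    and seg: "open_segment p q \<subseteq> interior K" and n: "n \<noteq> 0" "n \<bullet> (p - q) = 0"
    and z: "z \<in> frontier K" "n \<bullet> z = n \<bullet> p"
  shows "z \<in> {p, q}"
proof (rule ccontr)
  assume nz: "z \<notin> {p, q}"
  have fr: "frontier K = K - interior K" using K by (simp add: frontier_def)
  obtain s where "z - p = s *\<^sub>R (q - p)"
    using orthogonal_collinear_real2[of n "q - p" "z - p"] pq n z by (auto simp: inner_diff_right)
  then have zs: "z = p + s *\<^sub>R (q - p)" by (simp add: algebra_simps)
  define m where "m = (1/2) *\<^sub>R p + (1/2) *\<^sub>R q"
  have m: "m \<in> interior K"
    using seg pq(3) by (intro subsetD[OF seg]) (auto simp: m_def in_segment intro!: exI[of _ "1/2"])
  have "s \<noteq> 0" "s \<noteq> 1" using nz zs by auto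
  then consider "s < 0" | "0 < s" "s < 1" | "s > 1" by linarith
  then show False
  proof cases
    case 1
    \<comment> \<open>The factor is chosen so that the ray from \<open>z\<close> through
      \<open>p\<close> arrives exactly at \<open>m\<close>.\<close>
    have "p + (1 / (2 * - s)) *\<^sub>R (p - z) = p + (1 / 2) *\<^sub>R (q - p)"
      using 1 by (simp add: zs)
    also have "\<dots> = m" by (simp add: m_def vec_eq_iff field_simps)
    finally show False
      using notin_interior_halfline[OF K(1) pq(1), of z "1 / (2 * - s)"] m z fr 1 by simp
  next
    case 2
    have "z \<in> open_segment p q"
      using 2 pq(3) by (auto simp: zs in_segment algebra_simps intro!: exI[of _ s])
    then show False using seg z fr by auto
  next
    case 3
    have "q - z = (s - 1) *\<^sub>R (p - q)" by (simp add: zs algebra_simps)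
    then have "q + (1 / (2 * (s - 1))) *\<^sub>R (q - z) = q + (1 / 2) *\<^sub>R (p - q)"
      using 3 by simp
    also have "\<dots> = m" by (simp add: m_def vec_eq_iff field_simps)
    finally show False
      using notin_interior_halfline[OF K(1) pq(2), of z "1 / (2 * (s - 1))"] m z fr 3 by simp
  qed
qed

lemma connected_avoiding_hyperplane:
  fixes n :: "'a::real_inner"
  assumes "connected S" "\<And>z. z \<in> S \<Longrightarrow> n \<bullet> z \<noteq> c"
  shows "(\<forall>z\<in>S. n \<bullet> z < c) \<or> (\<forall>z\<in>S. n \<bullet> z > c)"
proof (rule ccontr)
  assume "\<not> ?thesis"
  then obtain x y where "x \<in> S" "y \<in> S" "n \<bullet> x \<le> c" "c \<le> n \<bullet> y"
    by (metis not_le order_less_imp_le)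
  then show False using connected_ivt_hyperplane[OF assms(1)] assms(2) by blast
qed

lemma frontier_beyond_hyperplane:
  fixes K :: "'a::euclidean_space set"
  assumes "compact K" "m \<in> interior K" "n \<noteq> 0"
  shows "\<exists>z\<in>frontier K. n \<bullet> z > n \<bullet> m"
proof -
  have "m \<in> K" using assms(2) interior_subset by blast
  then obtain s where s: "0 \<le> s" "m + s *\<^sub>R n \<in> frontier K"
    using exit_point_frontier[OF assms(1) _ assms(3)] by blast
  then have "s \<noteq> 0" using assms(2) by (auto simp: frontier_def)
  then show ?thesis using s assms(3) by (intro bexI[OF _ s(2)]) (auto simp: inner_add_right)
qed

lemma connected_arc_interior:
  assumes "arc h"
  shows "connected (path_image h - {h 0, h 1})"
proof -
  have inj: "inj_on h {0..1}" and c: "continuous_on {0..1} h"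
    using assms by (auto simp: arc_def path_def)
  have "path_image h - {h 0, h 1} = h ` ({0..1} - {0, 1})"
    unfolding path_image_def using inj_on_image_set_diff[OF inj, of "{0..1}" "{0, 1}"] by auto
  also have "{0..1} - {0, 1} = {0<..<1::real}" by auto
  finally show ?thesis
    using c by (auto intro!: connected_continuous_image intro: continuous_on_subset)
qed

text \<open>Without its ends each arc is connected and misses the line \<open>pq\<close>, so it
  stays on one side. The frontier has points strictly on both sides, so the arcs take different
  sides.\<close>

lemma chord_arcs_sides:
  fixes K :: "(real^2) set"
  assumes K: "convex K" "compact K" and pq: "p \<noteq> q"
    and seg: "open_segment p q \<subseteq> interior K" and n: "n \<noteq> 0" "n \<bullet> (p - q) = 0"
    and h: "arc h" "h 0 = p" "h 1 = q" and h': "arc h'" "h' 0 = q" "h' 1 = p"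
    and un: "path_image h \<union> path_image h' = frontier K"
    and int: "path_image h \<inter> path_image h' = {p, q}"
  shows "path_image h = frontier K \<inter> {z. n \<bullet> z \<le> n \<bullet> p} \<and>
         path_image h' = frontier K \<inter> {z. n \<bullet> z \<ge> n \<bullet> p} \<or>
         path_image h = frontier K \<inter> {z. n \<bullet> z \<ge> n \<bullet> p} \<and>
         path_image h' = frontier K \<inter> {z. n \<bullet> z \<le> n \<bullet> p}"
proof -
  have cl: "closed K" using K by (simp add: compact_imp_closed)
  have pqf: "p \<in> frontier K" "q \<in> frontier K" using un int by auto
  have np: "n \<bullet> q = n \<bullet> p" using n by (simp add: inner_diff_right)
  let ?A = "path_image h - {p, q}" and ?B = "path_image h' - {p, q}"
  have off: "n \<bullet> z \<noteq> n \<bullet> p" if "z \<in> frontier K" "z \<notin> {p, q}" for z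
    using frontier_on_chord_line[OF K(1) cl pqf pq seg n that(1)] that(2) by blast
  have A: "(\<forall>z\<in>?A. n \<bullet> z < n \<bullet> p) \<or> (\<forall>z\<in>?A. n \<bullet> z > n \<bullet> p)"
    using connected_arc_interior[OF h(1)] h off un
    by (intro connected_avoiding_hyperplane) auto
  have B: "(\<forall>z\<in>?B. n \<bullet> z < n \<bullet> p) \<or> (\<forall>z\<in>?B. n \<bullet> z > n \<bullet> p)"
    using connected_arc_interior[OF h'(1)] h' off un
    by (intro connected_avoiding_hyperplane) (auto simp: insert_commute)
  define m where "m = (1/2) *\<^sub>R p + (1/2) *\<^sub>R q"
  have m: "m \<in> interior K"
    using seg pq by (intro subsetD[OF seg]) (auto simp: m_def in_segment intro!: exI[of _ "1/2"])
  have nm: "n \<bullet> m = n \<bullet> p" by (simp add: m_def inner_add_right np)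
  obtain z1 where z1: "z1 \<in> frontier K" "n \<bullet> z1 > n \<bullet> p"
    using frontier_beyond_hyperplane[OF K(2) m n(1)] nm by auto
  obtain z2 where z2: "z2 \<in> frontier K" "n \<bullet> z2 < n \<bullet> p"
    using frontier_beyond_hyperplane[OF K(2) m, of "- n"] n(1) nm by auto
  have z12: "z1 \<in> ?A \<union> ?B" "z2 \<in> ?A \<union> ?B" using z1 z2 un np by auto
  have hsub: "{p, q} \<subseteq> path_image h" "{p, q} \<subseteq> path_image h'" using int by auto
  have side: "X = frontier K \<inter> {z. P z}"
    if un: "X \<union> Y = frontier K" and ends: "{p, q} \<subseteq> X" "P p" "P q"
      and X: "\<And>z. z \<in> X - {p, q} \<Longrightarrow> P z" and Y: "\<And>z. z \<in> Y - {p, q} \<Longrightarrow> \<not> P z"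
    for X Y and P :: "real^2 \<Rightarrow> bool"
  proof (rule set_eqI)
    fix z
    show "z \<in> X \<longleftrightarrow> z \<in> frontier K \<inter> {z. P z}"
      using ends X[of z] Y[of z] by (cases "z \<in> {p, q}") (auto simp flip: un)
  qed
  have un': "path_image h' \<union> path_image h = frontier K" using un by (simp add: Un_commute)
  from A show ?thesis
  proof
    assume A: "\<forall>z\<in>?A. n \<bullet> z < n \<bullet> p"
    then have B': "\<forall>z\<in>?B. n \<bullet> z > n \<bullet> p" using B z12 z1 by (auto dest: less_asym)
    have "path_image h = frontier K \<inter> {z. n \<bullet> z \<le> n \<bullet> p}"
      by (rule side[OF un hsub(1)]) (simp_all add: np A[rule_format] B'[rule_format] less_imp_le not_le)
    moreover have "path_image h' = frontier K \<inter> {z. n \<bullet> z \<ge> n \<bullet> p}"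
      by (rule side[OF un' hsub(2)]) (simp_all add: np A[rule_format] B'[rule_format] less_imp_le not_le)
    ultimately show ?thesis by blast
  next
    assume A: "\<forall>z\<in>?A. n \<bullet> z > n \<bullet> p"
    then have B': "\<forall>z\<in>?B. n \<bullet> z < n \<bullet> p" using B z12 z2 by (auto dest: less_asym)
    have "path_image h = frontier K \<inter> {z. n \<bullet> z \<ge> n \<bullet> p}"
      by (rule side[OF un hsub(1)]) (simp_all add: np A[rule_format] B'[rule_format] less_imp_le not_le)
    moreover have "path_image h' = frontier K \<inter> {z. n \<bullet> z \<le> n \<bullet> p}"
      by (rule side[OF un' hsub(2)]) (simp_all add: np A[rule_format] B'[rule_format] less_imp_le not_le)
    ultimately show ?thesis by blast
  qed
qed

subsection \<open>The two arcs cut off by a chord\<close>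

text \<open>The normal \<open>n\<close> is oriented so that \<open>h\<close> lies on its negative
  side. Equality of the arc lengths is not built in, because finiteness of length is proved for
  arbitrary chords through the interior.\<close>

locale chord_arcs =
  fixes K :: "(real^2) set" and p q n :: "real^2" and h h' :: "real \<Rightarrow> real^2"
  assumes convex: "convex K" and compact: "compact K" and pq: "p \<noteq> q"
    and interior: "open_segment p q \<subseteq> interior K"
    and n: "norm n = 1" "n \<bullet> (p - q) = 0"
    and h: "arc h" "h 0 = p" "h 1 = q" "path_image h = frontier K \<inter> {z. n \<bullet> z \<le> n \<bullet> p}"
    and h': "arc h'" "h' 0 = q" "h' 1 = p" "path_image h' = frontier K \<inter> {z. n \<bullet> z \<ge> n \<bullet> p}"
begin

text \<open>This symmetry transfers results about \<open>h\<close> to \<open>h'\<close> and lets the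
  side of \<open>h'\<close> be taken as the wider one.\<close>

lemma swapped: "chord_arcs K q p (- n) h' h"
  using convex compact pq interior n h h'
  by unfold_locales (auto simp: open_segment_commute inner_diff_right)

lemma frontier_ends: "p \<in> frontier K" "q \<in> frontier K"
  using h h' by (metis IntE pathfinish_def pathfinish_in_path_image pathstart_def pathstart_in_path_image)+

lemma normal_ends: "n \<bullet> q = n \<bullet> p"
  using n by (simp add: inner_diff_right)

lemma closed: "closed K"
  using compact by (rule compact_imp_closed)

lemma frontier_eq: "frontier K = K - interior K"
  using closed by (simp add: frontier_def)

lemma path_length_arc_le_detour:
  assumes "lip_joinable ({z. n \<bullet> z \<le> n \<bullet> p} - interior K) L p q"
  shows "path_length h \<le> ennreal L"
proof -
  have "lip_joinable (frontier K \<inter> {z. n \<bullet> z \<le> n \<bullet> p}) L p q"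
    using assms frontier_ends normal_ends closed convex
    by (intro lip_joinable_frontier_Int) (auto simp: convex_halfspace_le closed_halfspace_le)
  then show ?thesis using h by (intro path_length_arc_le) auto
qed

text \<open>The segment from \<open>x\<close> to \<open>e\<close> is prolonged beyond the frontier
  point \<open>e\<close>, which leads out of the interior and not back above the chord line.\<close>

lemma detour_along_chord:
  assumes x: "x \<in> K" "n \<bullet> p \<le> n \<bullet> x" and e: "e \<in> {p, q}" and r: "0 \<le> r"
  shows "closed_segment e (e + r *\<^sub>R (e - x)) \<subseteq> {z. n \<bullet> z \<le> n \<bullet> p} - interior K"
proof
  fix z assume "z \<in> closed_segment e (e + r *\<^sub>R (e - x))"
  then obtain s where s: "0 \<le> s" "s \<le> 1" "z = (1 - s) *\<^sub>R e + s *\<^sub>R (e + r *\<^sub>R (e - x))"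
    by (auto simp: in_segment)
  then have z: "z = e + (s * r) *\<^sub>R (e - x)" by (simp add: algebra_simps)
  have sr: "0 \<le> s * r" using s r by simp
  have "z \<notin> interior K"
    unfolding z using e frontier_ends sr x by (intro notin_interior_halfline[OF convex]) auto
  moreover have "n \<bullet> z \<le> n \<bullet> p"
  proof -
    have "n \<bullet> e = n \<bullet> p" using e normal_ends by auto
    then have "n \<bullet> z = n \<bullet> p + (s * r) * (n \<bullet> p - n \<bullet> x)"
      by (simp add: z inner_add_right inner_diff_right)
    moreover have "(s * r) * (n \<bullet> p - n \<bullet> x) \<le> 0" using sr x by (intro mult_nonneg_nonpos) auto
    ultimately show ?thesis by simp
  qed
  ultimately show "z \<in> {z. n \<bullet> z \<le> n \<bullet> p} - interior K" by simp
qed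

lemma detour_outside_halfspace:
  assumes out: "\<And>z. z \<in> K \<Longrightarrow> d \<bullet> z < c" and ab: "d \<bullet> a \<ge> c" "d \<bullet> b \<ge> c"
    and side: "n \<bullet> a \<le> n \<bullet> p" "n \<bullet> b \<le> n \<bullet> p"
  shows "closed_segment a b \<subseteq> {z. n \<bullet> z \<le> n \<bullet> p} - interior K"
proof -
  have "closed_segment a b \<subseteq> {z. n \<bullet> z \<le> n \<bullet> p} \<inter> {z. d \<bullet> z \<ge> c}"
    using ab side by (intro closed_segment_subset) (auto intro!: convex_Int convex_halfspace_le convex_halfspace_ge)
  moreover have "z \<notin> interior K" if "d \<bullet> z \<ge> c" for z
    using out that interior_subset by force
  ultimately show ?thesis by auto
qed

text \<open>An explicit detour of finite length: along the chord line beyond \<open>p\<close> to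
  \<open>a\<close>, around three sides of a rectangle outside \<open>K\<close> to \<open>b\<close>,
  and back along the line to \<open>q\<close>.\<close>

lemma path_length_arc_finite: "path_length h < \<infinity>"
proof -
  let ?S = "{z. n \<bullet> z \<le> n \<bullet> p} - interior K"
  obtain M where M: "M > 0" "\<And>z. z \<in> K \<Longrightarrow> dist p z < M"
    using bounded_subset_ballD[OF compact_imp_bounded[OF compact], of p] by (auto simp: subset_iff)
  have strip: "d \<bullet> z < d \<bullet> p + M * norm d" if "z \<in> K" "d \<noteq> 0" for d z
  proof -
    have "d \<bullet> (z - p) \<le> norm d * norm (z - p)" by (rule norm_cauchy_schwarz)
    also have "\<dots> < norm d * M" using M(2)[OF that(1)] that(2) by (simp add: dist_norm norm_minus_commute)
    finally show ?thesis by (simp add: inner_diff_right mult.commute)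
  qed
  have n0: "n \<noteq> 0" using n by auto
  define l where "l = norm (p - q)"
  have l: "l > 0" using pq by (simp add: l_def)
  \<comment> \<open>With this factor \<open>a\<close> and \<open>b\<close> are at distance
    \<open>M\<close> from \<open>p\<close> and \<open>q\<close>, beyond the reach of
    \<open>K\<close>.\<close>
  define k where "k = M / l"
  have k: "k > 0" using M l by (simp add: k_def)
  have pp: "(p - q) \<bullet> (p - q) = l * l" by (simp add: l_def power2_norm_eq_inner[symmetric] power2_eq_square)
  have kll: "k * (l * l) = M * l" using l by (simp add: k_def)
  have nn: "n \<bullet> n = 1" using n by (simp add: norm_eq_1)
  have pn: "(p - q) \<bullet> n = 0" using n by (simp add: inner_commute)
  define a b where "a = p + k *\<^sub>R (p - q)" and "b = q + k *\<^sub>R (q - p)"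
  have pK: "p \<in> K" "q \<in> K" using frontier_ends frontier_eq by auto
  have na: "n \<bullet> a = n \<bullet> p" "n \<bullet> b = n \<bullet> p"
    using n normal_ends by (simp_all add: a_def b_def inner_add_right inner_diff_right)
  have da: "(p - q) \<bullet> a = (p - q) \<bullet> p + M * l"
    by (simp add: a_def inner_add_right pp kll)
  have db: "(q - p) \<bullet> b = (q - p) \<bullet> p + M * l + l * l"
  proof -
    have "(q - p) \<bullet> (q - p) = l * l" using pp by (simp add: inner_diff_left inner_diff_right inner_commute)
    moreover have "b = p + (1 + k) *\<^sub>R (q - p)" by (simp add: b_def algebra_simps)
    ultimately show ?thesis by (simp add: inner_add_right distrib_right kll)
  qed
  have 1: "closed_segment p a \<subseteq> ?S"
    unfolding a_def using pK normal_ends k by (intro detour_along_chord) auto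
  have 2: "closed_segment a (a - M *\<^sub>R n) \<subseteq> ?S"
    using strip[of _ "p - q"] pq na da pn M nn
    by (intro detour_outside_halfspace[of "p - q" "(p - q) \<bullet> p + M * l"])
      (auto simp: l_def inner_diff_right)
  have 3: "closed_segment (a - M *\<^sub>R n) (b - M *\<^sub>R n) \<subseteq> ?S"
    using strip[of _ "- n"] n n0 na nn M
    by (intro detour_outside_halfspace[of "- n" "- n \<bullet> p + M"]) (auto simp: inner_diff_right)
  have 4: "closed_segment (b - M *\<^sub>R n) b \<subseteq> ?S"
    using strip[of _ "q - p"] pq na db pn M nn l
    by (intro detour_outside_halfspace[of "q - p" "(q - p) \<bullet> p + M * l"])
      (auto simp: l_def inner_diff_right inner_diff_left norm_minus_commute)
  have 5: "closed_segment b q \<subseteq> ?S"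
    unfolding b_def using pK normal_ends k
    by (subst closed_segment_commute, intro detour_along_chord) auto
  obtain L where "lip_joinable ?S L p q"
    using lip_joinable_trans[OF lip_joinable_trans[OF lip_joinable_trans[OF lip_joinable_trans[OF
      lip_joinable_segment[OF 1] lip_joinable_segment[OF 2]] lip_joinable_segment[OF 3]]
      lip_joinable_segment[OF 4]] lip_joinable_segment[OF 5]] by blast
  then have "path_length h \<le> ennreal L" by (rule path_length_arc_le_detour)
  then show ?thesis using le_less_trans ennreal_less_top by (metis infinity_ennreal_def)
qed

text \<open>If the chord \<open>uv\<close> were longer than \<open>pq\<close>, then prolonging \<open>up\<close> beyond \<open>p\<close> and \<open>vq\<close> beyond
  \<open>q\<close> up to the far supporting line would give a detour around \<open>h\<close> that is shorter than the
  polygon \<open>p, u, v, q\<close> inscribed in \<open>h'\<close>.\<close>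
lemma parallel_chord_le:
  assumes len: "path_length h' \<le> path_length h"
    and a: "0 \<le> a" "\<And>z. z \<in> K \<Longrightarrow> n \<bullet> p - a \<le> n \<bullet> z"
    and uv: "u \<in> K" "v \<in> K" "u - v = c *\<^sub>R (p - q)" and far: "a < n \<bullet> u - n \<bullet> p"
  shows "c \<le> 1"
proof (rule ccontr)
  assume "\<not> c \<le> 1"
  then have c: "c > 1" by simp
  \<comment> \<open>A chain inscribed in \<open>h'\<close> needs frontier points, so the chord is
    prolonged at both ends; this only increases its length.\<close>
  obtain s1 where s1: "0 \<le> s1" "u + s1 *\<^sub>R (p - q) \<in> frontier K"
    using exit_point_frontier[OF compact uv(1), of "p - q"] pq by auto
  obtain s2 where s2: "0 \<le> s2" "v + s2 *\<^sub>R (q - p) \<in> frontier K"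
    using exit_point_frontier[OF compact uv(2), of "q - p"] pq by auto
  define u' v' c' where "u' = u + s1 *\<^sub>R (p - q)" and "v' = v + s2 *\<^sub>R (q - p)" and "c' = c + s1 + s2"
  have c': "c' > 1" using c s1 s2 by (simp add: c'_def)
  have uv': "u' - v' = c' *\<^sub>R (p - q)"
  proof -
    have "u' - v' = (u - v) + s1 *\<^sub>R (p - q) + s2 *\<^sub>R (p - q)"
      by (simp add: u'_def v'_def algebra_simps)
    then show ?thesis by (simp add: uv(3) c'_def scaleR_add_left)
  qed
  have npq: "n \<bullet> p = n \<bullet> q" using normal_ends by simp
  define \<beta> where "\<beta> = n \<bullet> u - n \<bullet> p"
  have nuv: "n \<bullet> u' = n \<bullet> p + \<beta>" "n \<bullet> v' = n \<bullet> p + \<beta>"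
  proof -
    show nu: "n \<bullet> u' = n \<bullet> p + \<beta>" by (simp add: u'_def \<beta>_def inner_add_right n)
    have "n \<bullet> (u' - v') = 0" by (simp add: uv' n)
    then show "n \<bullet> v' = n \<bullet> p + \<beta>" using nu by (simp add: inner_diff_right)
  qed
  have \<beta>: "a < \<beta>" "0 < \<beta>" using far a(1) by (auto simp: \<beta>_def)
  \<comment> \<open>By similar triangles, prolonging \<open>u'p\<close> beyond \<open>p\<close> by
    the factor \<open>r\<close> descends by exactly \<open>a\<close>, onto the far line.\<close>
  define r where "r = a / \<beta>"
  have r: "0 \<le> r" "r < 1" "r * \<beta> = a" using \<beta> a(1) by (simp_all add: r_def)
  have fr: "u' \<in> frontier K" "v' \<in> frontier K" using s1 s2 by (simp_all add: u'_def v'_def)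
  then have K': "u' \<in> K" "v' \<in> K" by (simp_all add: frontier_eq)
  have im: "u' \<in> path_image h'" "v' \<in> path_image h'" using fr nuv \<beta> by (simp_all add: h')
  let ?S = "{z. n \<bullet> z \<le> n \<bullet> p} - interior K"
  define a1 a2 where "a1 = p + r *\<^sub>R (p - u')" and "a2 = q + r *\<^sub>R (q - v')"
  have 1: "closed_segment p a1 \<subseteq> ?S"
    unfolding a1_def using K' nuv \<beta> r by (intro detour_along_chord) auto
  have 3: "closed_segment a2 q \<subseteq> ?S"
    unfolding a2_def using K' nuv \<beta> r
    by (subst closed_segment_commute, intro detour_along_chord) auto
  have na: "n \<bullet> a1 = n \<bullet> p - a" "n \<bullet> a2 = n \<bullet> p - a"
    using r nuv npq by (simp_all add: a1_def a2_def inner_add_right inner_diff_right)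
  have 2: "closed_segment a1 a2 \<subseteq> ?S"
  proof
    fix z assume "z \<in> closed_segment a1 a2"
    then obtain s where "z = (1 - s) *\<^sub>R a1 + s *\<^sub>R a2" by (auto simp: in_segment)
    then have "n \<bullet> z = (1 - s) * (n \<bullet> p - a) + s * (n \<bullet> p - a)"
      by (simp add: inner_add_right na)
    then have z: "n \<bullet> z = n \<bullet> p - a" by (simp add: algebra_simps)
    have "z \<notin> interior K"
    proof
      assume "z \<in> interior K"
      then obtain e where e: "e > 0" "cball z e \<subseteq> K" by (meson mem_interior_cball)
      \<comment> \<open>An interior point on the far line would allow a step in direction
        \<open>- n\<close> inside \<open>K\<close>, below the lower bound.\<close>
      have "z - e *\<^sub>R n \<in> K" using e n by (intro subsetD[OF e(2)]) (simp add: dist_norm)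
      then have "n \<bullet> p - a \<le> n \<bullet> (z - e *\<^sub>R n)" by (rule a(2))
      moreover have "n \<bullet> n = 1" using n by (simp add: norm_eq_1)
      ultimately show False using e z by (simp add: inner_diff_right)
    qed
    then show "z \<in> ?S" using z a by simp
  qed
  have "path_length h \<le> ennreal (dist p a1 + dist a1 a2 + dist a2 q)"
    using lip_joinable_trans[OF lip_joinable_trans[OF lip_joinable_segment[OF 1] lip_joinable_segment[OF 2]]
      lip_joinable_segment[OF 3]]
    by (rule path_length_arc_le_detour)
  moreover have "ennreal (dist p u' + dist u' v' + dist v' q) \<le> path_length h'"
  proof -
    obtain s t where st: "s \<in> {0..1}" "t \<in> {0..1}" "u' = h' s" "v' = h' t"
      using im by (auto simp: path_image_def)
    show ?thesis
    \<comment> \<open>The order in which \<open>h'\<close> meets \<open>u'\<close> and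
      \<open>v'\<close> is unknown. In the wrong order the chain runs along the diagonals of the
      trapezoid, which are together at least as long as the legs.\<close>
    proof (cases "t \<le> s")
      case True
      then have "ennreal (dist q v' + dist v' u' + dist u' p) \<le> path_length h'"
        using path_length_ge_3[of t s h'] st h' by simp
      then show ?thesis by (simp only: dist_commute add.commute add.left_commute)
    next
      case False
      then have "ennreal (dist q u' + dist u' v' + dist v' p) \<le> path_length h'"
        using path_length_ge_3[of s t h'] st h' by simp
      moreover have "dist p u' + dist u' v' + dist v' q \<le> dist q u' + dist u' v' + dist v' p"
        using trapezoid_diagonals_ge_legs[OF _ uv'] c' by (simp add: dist_commute)
      ultimately show ?thesis by (meson ennreal_leI order_trans)
    qed
  qed
  ultimately have "ennreal (dist p u' + dist u' v' + dist v' q) \<le>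
      ennreal (dist p a1 + dist a1 a2 + dist a2 q)"
    using len by (meson order_trans)
  then have le: "dist p u' + dist u' v' + dist v' q \<le> dist p a1 + dist a1 a2 + dist a2 q"
    by (subst (asm) ennreal_le_iff) simp_all
  have d1: "dist p a1 = r * dist p u'" "dist a2 q = r * dist v' q"
    using r by (simp_all add: a1_def a2_def dist_norm norm_minus_commute)
  have "a1 - a2 = (p - q) + r *\<^sub>R (p - q) - r *\<^sub>R (u' - v')"
    by (simp add: a1_def a2_def algebra_simps)
  then have "a1 - a2 = (1 + r - r * c') *\<^sub>R (p - q)"
    by (simp add: uv' algebra_simps)
  then have "dist a1 a2 = \<bar>1 + r - r * c'\<bar> * dist p q" by (simp add: dist_norm)
  also have "\<dots> \<le> c' * dist p q"
  proof (rule mult_right_mono)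
    \<comment> \<open>The factor \<open>1 + r - r * c'\<close> is negative if the prolonged legs
      cross before the far line; \<open>c'\<close> bounds its absolute value for either
      sign.\<close>
    have "0 \<le> r * c'" "r * c' \<le> c'" "r \<le> r * c'"
      using r c' mult_left_mono[of 1 c' r] by (simp_all add: mult_left_le_one_le)
    then show "\<bar>1 + r - r * c'\<bar> \<le> c'" using r c' by linarith
  qed simp
  also have "\<dots> = dist u' v'" using c' by (simp add: dist_norm uv')
  finally have "dist a1 a2 \<le> dist u' v'" .
  moreover have "r * dist v' q \<le> dist v' q" using r by (simp add: mult_left_le_one_le)
  \<comment> \<open>The strictness of the contradiction comes from this leg: \<open>r < 1\<close>,
    and \<open>u'\<close> is off the chord line.\<close>
  moreover have "r * dist p u' < dist p u'" using r nuv \<beta> by (cases "p = u'") auto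
  ultimately show False using le d1 by linarith
qed

end

subsection \<open>Area by parallel sections\<close>

lemma emeasure_compact_real_le:
  fixes T :: "real set"
  assumes "compact T" "\<And>y y'. y \<in> T \<Longrightarrow> y' \<in> T \<Longrightarrow> y - y' \<le> l" "0 \<le> l"
  shows "emeasure lborel T \<le> ennreal l"
proof (cases "T = {}")
  case False
  then obtain y y' where y: "y \<in> T" "\<And>z. z \<in> T \<Longrightarrow> z \<le> y" and y': "y' \<in> T" "\<And>z. z \<in> T \<Longrightarrow> y' \<le> z"
    using compact_attains_sup[OF assms(1)] compact_attains_inf[OF assms(1)] by metis
  have "emeasure lborel T \<le> emeasure lborel {y'..y}"
    using y y' by (intro emeasure_mono) auto
  also have "\<dots> \<le> ennreal l"
    using y y' assms(2)[OF y(1) y'(1)] by (simp add: ennreal_leI)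
  finally show ?thesis .
qed (use assms in auto)

text \<open>Each set is enclosed in the interval between its extreme points. Nonemptiness matters
  because for an empty set the bound \<open>le\<close> would be vacuous and say nothing about the
  other.\<close>

lemma emeasure_two_compact_real_le:
  fixes T U :: "real set"
  assumes "compact T" "compact U" "T \<noteq> {}" "U \<noteq> {}"
    and le: "\<And>y y' z z'. y \<in> T \<Longrightarrow> y' \<in> T \<Longrightarrow> z \<in> U \<Longrightarrow> z' \<in> U \<Longrightarrow> (y - y') + (z - z') \<le> l"
  shows "emeasure lborel T + emeasure lborel U \<le> ennreal l"
proof -
  obtain y y' where y: "y \<in> T" "\<And>z. z \<in> T \<Longrightarrow> z \<le> y" and y': "y' \<in> T" "\<And>z. z \<in> T \<Longrightarrow> y' \<le> z"
    using compact_attains_sup[OF assms(1,3)] compact_attains_inf[OF assms(1,3)] by metis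
  obtain u u' where u: "u \<in> U" "\<And>z. z \<in> U \<Longrightarrow> z \<le> u" and u': "u' \<in> U" "\<And>z. z \<in> U \<Longrightarrow> u' \<le> z"
    using compact_attains_sup[OF assms(2,4)] compact_attains_inf[OF assms(2,4)] by metis
  have "emeasure lborel T + emeasure lborel U \<le> emeasure lborel {y'..y} + emeasure lborel {u'..u}"
    using y y' u u' by (intro add_mono emeasure_mono) auto
  also have "\<dots> = ennreal ((y - y') + (u - u'))"
    using y(2)[OF y'(1)] u(2)[OF u'(1)] by simp
  also have "\<dots> \<le> ennreal l"
    using le y(1) y'(1) u(1) u'(1) by (intro ennreal_leI) blast
  finally show ?thesis .
qed

text \<open>The sections at \<open>x\<close> and \<open>- x\<close> are integrated together.\<close>
lemma emeasure_le_of_sections: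
  fixes S :: "(real \<times> real) set"
  assumes S: "compact S" and ab: "0 \<le> a" "a \<le> b" and l: "0 \<le> l"
    and extent: "\<And>x y. (x, y) \<in> S \<Longrightarrow> - a \<le> x \<and> x \<le> b"
    and outer: "\<And>x y y'. (x, y) \<in> S \<Longrightarrow> (x, y') \<in> S \<Longrightarrow> a < x \<Longrightarrow> y - y' \<le> l"
    and inner: "\<And>x y y' z z'. (x, y) \<in> S \<Longrightarrow> (x, y') \<in> S \<Longrightarrow> (- x, z) \<in> S \<Longrightarrow> (- x, z') \<in> S \<Longrightarrow>
      (y - y') + (z - z') \<le> 2 * l"
    and ne: "\<And>x. \<bar>x\<bar> \<le> a \<Longrightarrow> \<exists>y. (x, y) \<in> S"
  shows "emeasure lborel S \<le> ennreal (l * (a + b))"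
proof -
  define c where "c x = emeasure lborel (Pair x -` S)" for x
  have cS: "compact (Pair x -` S)" for x
  proof -
    have "Pair x -` S = snd ` (S \<inter> ({x} \<times> UNIV))" by force
    moreover have "compact (S \<inter> ({x} \<times> UNIV))"
      by (intro compact_Int_closed S closed_Times) auto
    ultimately show ?thesis
      by (simp only:) (rule compact_continuous_image[OF continuous_on_snd[OF continuous_on_id]])
  qed
  have Sb: "S \<in> sets (lborel \<Otimes>\<^sub>M lborel)"
    unfolding lborel_prod using S by (simp add: borel_compact)
  have cm [measurable]: "c \<in> borel_measurable borel"
    using lborel.measurable_emeasure_Pair[OF Sb] by (simp add: c_def[abs_def])
  \<comment> \<open>The range of heights is cut at 0 and \<open>a\<close>; half-open pieces keep the
    section at 0 from being counted twice after \<open>?L\<close> is reflected.\<close>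
  let ?L = "\<lambda>x. c x * indicator {-a..<0} x"
  let ?M = "\<lambda>x. c x * indicator {0..a} x"
  let ?R = "\<lambda>x. c x * indicator {a<..b} x"
  have c0: "c x = 0" if "x < - a \<or> b < x" for x
  proof -
    have "Pair x -` S = {}" using extent that by force
    then show ?thesis by (simp add: c_def)
  qed
  have "emeasure lborel S = (\<integral>\<^sup>+x. c x \<partial>lborel)"
    using lborel.emeasure_pair_measure_alt[OF Sb] by (simp add: lborel_prod c_def)
  also have "\<dots> = (\<integral>\<^sup>+x. ?L x + (?M x + ?R x) \<partial>lborel)"
    using ab by (intro nn_integral_cong) (auto simp: indicator_def not_less c0)
  also have "\<dots> = (\<integral>\<^sup>+x. ?L x \<partial>lborel) + (\<integral>\<^sup>+x. ?M x + ?R x \<partial>lborel)"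
    by (intro nn_integral_add) auto
  also have "(\<integral>\<^sup>+x. ?L x \<partial>lborel) = (\<integral>\<^sup>+x. ?L (- x) \<partial>lborel)"
    by (subst nn_integral_real_affine[where c = "-1" and t = 0]) auto
  also have "\<dots> + (\<integral>\<^sup>+x. ?M x + ?R x \<partial>lborel) = (\<integral>\<^sup>+x. ?L (- x) + (?M x + ?R x) \<partial>lborel)"
    by (intro nn_integral_add[symmetric]) auto
  also have "\<dots> \<le> (\<integral>\<^sup>+x. ennreal (2 * l) * indicator {0..a} x + ennreal l * indicator {a<..b} x \<partial>lborel)"
  proof (rule nn_integral_mono)
    fix x :: real
    consider "x < 0" | "0 \<le> x" "x \<le> a" | "a < x" "x \<le> b" | "x > b" "x > a" using ab by linarith
    then show "?L (- x) + (?M x + ?R x) \<le> ennreal (2 * l) * indicator {0..a} x + ennreal l * indicator {a<..b} x"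
    proof cases
      case 2
      have "c (- x) + c x \<le> ennreal (2 * l)"
        unfolding c_def using 2 ab ne[of x] ne[of "- x"] inner[of "- x"]
        by (intro emeasure_two_compact_real_le cS) auto
      then have "?L (- x) + ?M x \<le> ennreal (2 * l)"
        using 2 by (cases "x = 0") (auto simp: indicator_def intro: order_trans[rotated])
      then show ?thesis using 2 by (simp add: indicator_def)
    next
      case 3
      have "c x \<le> ennreal l"
        unfolding c_def using 3 outer by (intro emeasure_compact_real_le cS l) auto
      then show ?thesis using 3 ab by (simp add: indicator_def)
    qed (use ab in \<open>auto simp: indicator_def\<close>)
  qed
  also have "\<dots> = ennreal (2 * l) * ennreal a + ennreal l * ennreal (b - a)"
    using ab by (subst nn_integral_add) (auto simp: nn_integral_cmult_indicator)
  also have "\<dots> = ennreal (l * (a + b))"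
    using ab l by (simp flip: ennreal_mult ennreal_plus) (simp add: algebra_simps)
  finally show ?thesis .
qed

section \<open>Plane area in an orthonormal frame\<close>

text \<open>Fubini applies to pairs while the curve lives in \<open>real^2\<close>. The preimage of
  a box under the coordinate map is a box of the same area, and boxes determine Lebesgue
  measure.\<close>

lemma lborel_real2: "distr lborel borel (\<lambda>(x, y). vector [x, y] :: real^2) = lborel"
proof (rule lborel_eqI[symmetric])
  let ?f = "\<lambda>(x, y). vector [x, y] :: real^2"
  have "?f = (\<lambda>z. fst z *\<^sub>R axis 1 1 + snd z *\<^sub>R axis 2 1)"
    by (auto simp: fun_eq_iff vec_eq_iff forall_2 axis_def)
  then have "continuous_on UNIV ?f" by (simp only:) (intro continuous_intros)
  then have fm: "?f \<in> borel_measurable borel" by (rule borel_measurable_continuous_onI)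
  fix l u :: "real^2" assume lu: "\<And>b. b \<in> Basis \<Longrightarrow> l \<bullet> b \<le> u \<bullet> b"
  have B: "Basis = {axis 1 1, axis 2 1 :: real^2}" by (auto simp: Basis_vec_def UNIV_2)
  have pre: "?f -` box l u = box (l$1, l$2) (u$1, u$2)"
    by (auto simp: box_def B inner_axis Basis_prod_def)
  have ne: "axis 1 1 \<noteq> (axis 2 1 :: real^2)" by (simp add: axis_eq_axis)
  have "emeasure (distr lborel borel ?f) (box l u) = emeasure lborel (box (l$1, l$2) (u$1, u$2))"
    using fm by (subst emeasure_distr) (auto simp: pre)
  also have "\<dots> = (\<Prod>b\<in>Basis. (u - l) \<bullet> b)"
    using lu[of "axis 1 1"] lu[of "axis 2 1"]
    by (subst emeasure_lborel_box) (auto simp: B ne inner_axis Basis_prod_def mult.commute)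
  finally show "emeasure (distr lborel borel ?f) (box l u) = (\<Prod>b\<in>Basis. (u - l) \<bullet> b)" .
qed simp

text \<open>Passing to coordinates along \<open>n\<close> and \<open>e\<close> with origin
  \<open>p\<close> is a translation and an orthogonal map, both of which preserve area.\<close>

lemma measure_frame_real2:
  fixes K :: "(real^2) set" and p n e :: "real^2"
  assumes K: "compact K" and ne: "norm n = 1" "norm e = 1" "n \<bullet> e = 0"
  defines "S \<equiv> {(x, y). p + x *\<^sub>R n + y *\<^sub>R e \<in> K}"
  shows "compact S" "measure lebesgue K = measure lborel S"
proof -
  define f where "f z = z$1 *\<^sub>R n + z$2 *\<^sub>R e" for z :: "real^2"
  have dots: "n \<bullet> n = 1" "e \<bullet> e = 1" "e \<bullet> n = 0" using ne by (simp_all add: norm_eq_1 inner_commute)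
  have orth: "orthogonal_transformation f"
    unfolding orthogonal_transformation_def
  proof
    show "linear f" by (simp add: linear_iff f_def algebra_simps)
    have "f v \<bullet> f w = v$1 * w$1 + v$2 * w$2" for v w
      by (simp add: f_def inner_add_left inner_add_right dots ne(3))
    then show "\<forall>v w. f v \<bullet> f w = v \<bullet> w"
      by (simp add: inner_vec_def sum_2)
  qed
  define T where "T = {z. p + f z \<in> K}"
  have surj: "surj f" using orth by (rule orthogonal_transformation_surj)
  have KT: "K = (\<lambda>z. p + z) ` f ` T"
  proof
    show "K \<subseteq> (\<lambda>z. p + z) ` f ` T"
    proof
      fix z assume "z \<in> K"
      moreover obtain w where "z - p = f w" using surj by (metis surjD)
      then have "z = p + f w" by (simp add: algebra_simps)
      ultimately show "z \<in> (\<lambda>z. p + z) ` f ` T" by (auto simp: T_def)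
    qed
  qed (auto simp: T_def)
  have T: "compact T"
  proof -
    define g where "g = inv f"
    have fg: "f (g z) = z" "g (f w) = w" for z w
      using surj orthogonal_transformation_inj[OF orth] by (simp_all add: g_def surj_f_inv_f)
    have "continuous_on UNIV g"
      using orthogonal_transformation_inv[OF orth] unfolding g_def
      by (metis linear_continuous_on linear_conv_bounded_linear orthogonal_transformation_linear)
    moreover have "T = (\<lambda>z. g (z - p)) ` K"
      unfolding T_def by (auto simp: fg image_iff) (metis add_diff_cancel_left' fg(2))
    ultimately show ?thesis
      by (auto intro!: compact_continuous_image K continuous_on_compose2[of UNIV g] continuous_intros)
  qed
  have "measure lebesgue K = measure lebesgue (f ` T)"
    by (subst KT) (rule measure_translation)
  also have "\<dots> = measure lebesgue T"
    using T by (intro measure_orthogonal_image orth lmeasurable_compact)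
  also have "\<dots> = measure lborel T"
    using T by (intro measure_completion) (auto simp: borel_compact)
  also have "\<dots> = measure lborel S"
  proof -
    let ?f = "\<lambda>(x, y). vector [x, y] :: real^2"
    have "?f = (\<lambda>z. fst z *\<^sub>R axis 1 1 + snd z *\<^sub>R axis 2 1)"
      by (auto simp: fun_eq_iff vec_eq_iff forall_2 axis_def)
    then have "?f \<in> borel_measurable borel"
      by (simp only:) (intro borel_measurable_continuous_onI continuous_intros)
    then have "measure (distr lborel borel ?f) T = measure lborel (?f -` T)"
      using T by (subst measure_distr) (auto simp: borel_compact)
    moreover have "?f -` T = S" by (auto simp: T_def S_def f_def add.assoc)
    ultimately show ?thesis by (simp add: lborel_real2)
  qed
  finally show "measure lebesgue K = measure lborel S" .
  have "S = (\<lambda>z. (z$1, z$2)) ` T"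
  proof -
    have "(x, y) \<in> (\<lambda>z. (z$1, z$2)) ` T" if "(x, y) \<in> S" for x y
      using that by (intro image_eqI[of _ _ "vector [x, y]"]) (auto simp: S_def T_def f_def add.assoc)
    then show ?thesis by (auto simp: S_def T_def f_def add.assoc)
  qed
  then show "compact S"
    using T by (auto intro!: compact_continuous_image continuous_intros)
qed

subsection \<open>The area estimate and existence of halving pairs\<close>

context chord_arcs
begin

text \<open>Prolonged to the frontier, \<open>uv\<close> must end in \<open>p\<close> or
  \<open>q\<close>, the only frontier points on that line; so it is at most as long as
  \<open>pq\<close>. This bounds the section at height 0, on which the paired estimate
  rests.\<close>

lemma chord_on_line_le:
  assumes uv: "u \<in> K" "v \<in> K" "u - v = c *\<^sub>R (p - q)" and on: "n \<bullet> u = n \<bullet> p"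
  shows "c \<le> 1"
proof (rule ccontr)
  assume "\<not> c \<le> 1"
  then have c: "c > 1" by simp
  obtain s1 where s1: "0 \<le> s1" "u + s1 *\<^sub>R (p - q) \<in> frontier K"
    using exit_point_frontier[OF compact uv(1), of "p - q"] pq by auto
  obtain s2 where s2: "0 \<le> s2" "v + s2 *\<^sub>R (q - p) \<in> frontier K"
    using exit_point_frontier[OF compact uv(2), of "q - p"] pq by auto
  have n0: "n \<noteq> 0" using n by auto
  have "n \<bullet> (u - v) = 0" by (simp add: uv n)
  then have nv: "n \<bullet> v = n \<bullet> p" using on by (simp add: inner_diff_right)
  have "u + s1 *\<^sub>R (p - q) \<in> {p, q}"
    using on n by (intro frontier_on_chord_line[OF convex closed frontier_ends pq interior n0 n(2) s1(2)])
      (simp add: inner_add_right)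
  moreover have "v + s2 *\<^sub>R (q - p) \<in> {p, q}"
    using nv n normal_ends
    by (intro frontier_on_chord_line[OF convex closed frontier_ends pq interior n0 n(2) s2(2)])
      (simp add: inner_add_right inner_diff_right)
  moreover have "(u + s1 *\<^sub>R (p - q)) - (v + s2 *\<^sub>R (q - p)) = (u - v) + s1 *\<^sub>R (p - q) + s2 *\<^sub>R (p - q)"
    by (simp add: algebra_simps)
  then have "(u + s1 *\<^sub>R (p - q)) - (v + s2 *\<^sub>R (q - p)) = (c + s1 + s2) *\<^sub>R (p - q)"
    by (simp add: uv(3) scaleR_add_left)
  ultimately have "(c + s1 + s2) *\<^sub>R (p - q) \<in> {0, p - q, q - p}"
    by (metis (no_types, lifting) diff_self insert_iff singletonD)
  then have "(c + s1 + s2) *\<^sub>R (p - q) \<in> {0 *\<^sub>R (p - q), 1 *\<^sub>R (p - q), (- 1) *\<^sub>R (p - q)}" by simp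
  then have "c + s1 + s2 \<in> {0, 1, - 1}" using pq by (simp only: insert_iff empty_iff scaleR_cancel_right) simp
  then show False using c s1 s2 by auto
qed

text \<open>Sections are taken parallel to \<open>pq\<close>, with \<open>x\<close> the signed
  height above the chord line; \<open>a\<close> and \<open>b\<close> are the extents on the sides of
  \<open>h\<close> and \<open>h'\<close>.\<close>

lemma measure_le:
  assumes len: "path_length h' \<le> path_length h"
    and zmin: "zmin \<in> K" "\<And>z. z \<in> K \<Longrightarrow> n \<bullet> zmin \<le> n \<bullet> z"
    and zmax: "zmax \<in> K" "\<And>z. z \<in> K \<Longrightarrow> n \<bullet> z \<le> n \<bullet> zmax"
    and le: "n \<bullet> p - n \<bullet> zmin \<le> n \<bullet> zmax - n \<bullet> p"
  shows "measure lebesgue K \<le> dist p q * (n \<bullet> zmax - n \<bullet> zmin)"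
proof -
  define l where "l = dist p q"
  have l: "l > 0" using pq by (simp add: l_def)
  define e where "e = (1 / l) *\<^sub>R (p - q)"
  have pqe: "p - q = l *\<^sub>R e" using l by (simp add: e_def)
  have e: "norm e = 1" "n \<bullet> e = 0" using l n by (simp_all add: e_def l_def dist_norm)
  have nn: "n \<bullet> n = 1" using n by (simp add: norm_eq_1)
  have pK: "p \<in> K" using frontier_ends frontier_eq by auto
  define a b where "a = n \<bullet> p - n \<bullet> zmin" and "b = n \<bullet> zmax - n \<bullet> p"
  have ab: "0 \<le> a" "a \<le> b" using zmin(2)[OF pK] le by (simp_all add: a_def b_def)
  define P where "P x y = p + x *\<^sub>R n + y *\<^sub>R e" for x y
  have nP: "n \<bullet> P x y = n \<bullet> p + x" for x y by (simp add: P_def inner_add_right nn e)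
  have diff: "P x y - P x y' = ((y - y') / l) *\<^sub>R (p - q)" for x y y'
    unfolding pqe scaleR_scaleR using l by (simp add: P_def scaleR_diff_left)
  \<comment> \<open>The remaining heights get no bound of their own and are treated in
    pairs.\<close>
  have chord: "y - y' \<le> l" if "P x y \<in> K" "P x y' \<in> K" "x = 0 \<or> a < x" for x y y'
  proof -
    have "(y - y') / l \<le> 1"
    proof (cases "x = 0")
      case True
      then show ?thesis using chord_on_line_le[OF that(1,2) diff] nP by simp
    next
      case False
      then show ?thesis
        using parallel_chord_le[OF len ab(1) _ that(1,2) diff] that(3) zmin nP by (auto simp: a_def)
    qed
    then show ?thesis using l by (simp add: divide_le_eq)
  qed
  define S where "S = {(x, y). P x y \<in> K}"
  have S: "compact S" "measure lebesgue K = measure lborel S"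
    using measure_frame_real2[OF compact n(1) e, of p] by (simp_all add: S_def P_def)
  have "emeasure lborel S \<le> ennreal (l * (a + b))"
  proof (rule emeasure_le_of_sections[OF S(1) ab])
    show "0 \<le> l" using l by simp
  next
    fix x y assume "(x, y) \<in> S"
    then have "P x y \<in> K" by (simp add: S_def)
    then show "- a \<le> x \<and> x \<le> b" using zmin(2) zmax(2) nP by (force simp: a_def b_def)
  next
    fix x y y' assume "(x, y) \<in> S" "(x, y') \<in> S" "a < x"
    then show "y - y' \<le> l" using chord[of x y y'] by (simp add: S_def)
  next
    fix x y y' z z' assume "(x, y) \<in> S" "(x, y') \<in> S" "(- x, z) \<in> S" "(- x, z') \<in> S"
    then have K: "P x y \<in> K" "P x y' \<in> K" "P (- x) z \<in> K" "P (- x) z' \<in> K" by (simp_all add: S_def)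
    \<comment> \<open>Midpoints of points at heights \<open>x\<close> and \<open>- x\<close> lie on
      the chord line, so the mean of the two section widths is at most \<open>l\<close>.\<close>
    have mid: "P 0 ((y + z) / 2) \<in> K" if "P x y \<in> K" "P (- x) z \<in> K" for y z
    proof -
      have "(1/2) *\<^sub>R P x y + (1/2) *\<^sub>R P (- x) z \<in> K"
        using that by (intro convexD[OF convex]) auto
      moreover have "(1/2) *\<^sub>R P x y + (1/2) *\<^sub>R P (- x) z = P 0 ((y + z) / 2)"
        by (simp add: P_def vec_eq_iff field_simps)
      ultimately show ?thesis by simp
    qed
    have "(y + z) / 2 - (y' + z') / 2 \<le> l"
      using mid K by (intro chord[of 0]) auto
    then show "(y - y') + (z - z') \<le> 2 * l" by argo
  next
    fix x :: real assume x: "\<bar>x\<bar> \<le> a"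
    have "n \<bullet> zmin \<le> n \<bullet> p + x" "n \<bullet> p + x \<le> n \<bullet> zmax" using x ab by (auto simp: a_def b_def)
    \<comment> \<open>\<open>K\<close> is connected and reaches heights \<open>- a\<close> and
      \<open>b \<ge> a\<close>, so each section within distance \<open>a\<close> of the chord is
      nonempty.\<close>
    then obtain z where z: "z \<in> K" "n \<bullet> z = n \<bullet> p + x"
      using connected_ivt_hyperplane[OF convex_connected[OF convex] zmin(1) zmax(1)] by blast
    have n0: "n \<noteq> 0" using n by auto
    have "e \<noteq> 0" using e by auto
    moreover have "n \<bullet> (z - p - x *\<^sub>R n) = 0" using z nn by (simp add: inner_diff_right)
    ultimately obtain y where "z - p - x *\<^sub>R n = y *\<^sub>R e"
      using orthogonal_collinear_real2[OF n0 _ e(2)] by blast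
    then have "z = P x y" by (simp add: P_def algebra_simps)
    then show "\<exists>y. (x, y) \<in> S" using z by (auto simp: S_def)
  qed
  then have "measure lborel S \<le> l * (a + b)"
    unfolding measure_def using l ab by (intro enn2real_leI) auto
  then show ?thesis by (simp add: S(2) l_def a_def b_def)
qed

text \<open>The wider side may belong to \<open>h'\<close> by \<open>swapped\<close>. The width of
  \<open>K\<close> in direction \<open>n\<close> is at most the distance of two extreme
  points.\<close>

lemma measure_le_diameter:
  assumes len: "path_length h = path_length h'"
  shows "measure lebesgue K \<le> diameter (frontier K) * dist p q"
proof -
  have ne: "K \<noteq> {}" using frontier_ends frontier_eq by auto
  have cn: "continuous_on K (\<lambda>z. n \<bullet> z)" by (intro continuous_intros)
  obtain zmin where zmin: "zmin \<in> K" "\<And>z. z \<in> K \<Longrightarrow> n \<bullet> zmin \<le> n \<bullet> z"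
    using continuous_attains_inf[OF compact ne cn] by blast
  obtain zmax where zmax: "zmax \<in> K" "\<And>z. z \<in> K \<Longrightarrow> n \<bullet> z \<le> n \<bullet> zmax"
    using continuous_attains_sup[OF compact ne cn] by blast
  have "measure lebesgue K \<le> dist p q * (n \<bullet> zmax - n \<bullet> zmin)"
  proof (cases "n \<bullet> p - n \<bullet> zmin \<le> n \<bullet> zmax - n \<bullet> p")
    case True
    then show ?thesis using measure_le[OF _ zmin zmax] len by simp
  next
    case False
    then show ?thesis
      using chord_arcs.measure_le[OF swapped _ zmax(1) _ zmin(1)] zmax(2) zmin(2) len normal_ends
      by (simp add: dist_commute)
  qed
  also have "\<dots> \<le> dist p q * diameter (frontier K)"
  proof (rule mult_left_mono)
    \<comment> \<open>Points extreme in a direction lie on the frontier, so their distance is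
      bounded by the diameter of the curve itself.\<close>
    have ext: "z \<in> frontier K" if z: "z \<in> K" and max: "\<And>y. y \<in> K \<Longrightarrow> d \<bullet> y \<le> d \<bullet> z" and d: "norm d = 1" for z d
    proof -
      have "z \<notin> interior K"
      proof
        assume "z \<in> interior K"
        then obtain r where r: "r > 0" "cball z r \<subseteq> K" by (meson mem_interior_cball)
        have "z + r *\<^sub>R d \<in> K" using r d by (intro subsetD[OF r(2)]) (simp add: dist_norm)
        then have "d \<bullet> (z + r *\<^sub>R d) \<le> d \<bullet> z" by (rule max)
        moreover have "d \<bullet> d = 1" using d by (simp add: norm_eq_1)
        ultimately show False using r by (simp add: inner_add_right)
      qed
      then show ?thesis using z frontier_eq by simp
    qed
    have "zmax \<in> frontier K" using ext[OF zmax] n by blast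
    moreover have "zmin \<in> frontier K" using ext[OF zmin(1), of "- n"] zmin(2) n by simp
    moreover have "bounded (frontier K)"
      using compact by (intro compact_imp_bounded compact_frontier)
    ultimately have "dist zmax zmin \<le> diameter (frontier K)"
      by (intro diameter_bounded_bound)
    moreover have "n \<bullet> (zmax - zmin) \<le> norm n * norm (zmax - zmin)" by (rule norm_cauchy_schwarz)
    ultimately show "n \<bullet> zmax - n \<bullet> zmin \<le> diameter (frontier K)"
      using n by (simp add: dist_norm inner_diff_right)
  qed simp
  finally show ?thesis by (simp add: mult.commute)
qed

end

section \<open>Loops around a convex body and halving pairs\<close>

lemma simple_loop_chord_arcs:
  fixes K :: "(real^2) set" and g :: "real \<Rightarrow> real^2"
  assumes K: "convex K" "compact K"
    and g: "simple_path g" "pathfinish g = pathstart g" "path_image g = frontier K" and t: "t \<in> {0<..<1}"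
    and seg: "open_segment (g 0) (g t) \<subseteq> interior K"
  obtains n where "chord_arcs K (g 0) (g t) n (subpath 0 t g) (subpath t 1 g)"
proof -
  note arcs = simple_loop_arcs[OF g(1,2) t]
  define d where "d = g 0 - g t"
  \<comment> \<open>The chord direction turned by a right angle; its sign is settled at the end by
    the side on which the first arc lies.\<close>
  define n where "n = (1 / norm d) *\<^sub>R (vector [- d$2, d$1] :: real^2)"
  have d: "d \<noteq> 0" using arcs(1) by (simp add: d_def)
  have "norm (vector [- d$2, d$1] :: real^2) = norm d"
    by (simp add: norm_vec_def L2_set_def sum_2 add.commute)
  then have n1: "norm n = 1" using d by (simp add: n_def)
  have nd: "n \<bullet> d = 0" by (simp add: n_def inner_vec_def sum_2)
  have n0: "n \<noteq> 0" using n1 by auto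
  have "path_image (subpath 0 t g) = frontier K \<inter> {z. n \<bullet> z \<le> n \<bullet> g 0} \<and>
         path_image (subpath t 1 g) = frontier K \<inter> {z. n \<bullet> z \<ge> n \<bullet> g 0} \<or>
         path_image (subpath 0 t g) = frontier K \<inter> {z. n \<bullet> z \<ge> n \<bullet> g 0} \<and>
         path_image (subpath t 1 g) = frontier K \<inter> {z. n \<bullet> z \<le> n \<bullet> g 0}"
    using arcs g(3) nd unfolding d_def by (intro chord_arcs_sides[OF K arcs(1) seg n0]) auto
  then consider
      "chord_arcs K (g 0) (g t) n (subpath 0 t g) (subpath t 1 g)"
    | "chord_arcs K (g 0) (g t) (- n) (subpath 0 t g) (subpath t 1 g)"
    unfolding chord_arcs_def using K arcs seg n1 nd by (auto simp: d_def)
  then show ?thesis using that by cases blast+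
qed

text \<open>Bounded convex sets of equal dimension have homeomorphic relative frontiers, so the
  parametrized unit circle can be carried over.\<close>

lemma frontier_simple_loop:
  fixes K :: "(real^2) set"
  assumes K: "convex K" "compact K" "interior K \<noteq> {}"
  obtains g where "simple_path g" "pathfinish g = pathstart g" "path_image g = frontier K"
proof -
  have "rel_frontier (cball 0 1 :: complex set) homeomorphic rel_frontier K"
    using K by (intro homeomorphic_rel_frontiers_convex_bounded_sets)
      (auto simp: compact_imp_bounded aff_dim_nonempty_interior)
  then obtain f f' where f: "homeomorphism (sphere 0 1 :: complex set) (frontier K) f f'"
    using K by (auto simp: rel_frontier_nonempty_interior homeomorphic_def)
  let ?c = "circlepath 0 1"
  have im: "path_image ?c = sphere 0 1" by simp
  have inj: "inj_on f (sphere 0 1)" and c: "continuous_on (sphere 0 1) f" and fim: "f ` sphere 0 1 = frontier K"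
    using f unfolding homeomorphism_def by (auto intro: inj_on_inverseI)
  show ?thesis
  proof
    show "simple_path (f \<circ> ?c)"
      using inj c by (intro simple_path_continuous_image) (simp_all add: simple_path_circlepath)
    show "pathfinish (f \<circ> ?c) = pathstart (f \<circ> ?c)"
      by (simp add: pathfinish_compose pathstart_compose)
    show "path_image (f \<circ> ?c) = frontier K"
      by (simp add: path_image_compose fim)
  qed
qed

text \<open>A chord from \<open>g 0\<close> through an interior point splits the loop into two arcs
  of finite length. The loop thus has finite positive length and can be bisected, starting at
  \<open>g 0\<close>.\<close>

lemma halving_pair_exists:
  fixes K :: "(real^2) set"
  assumes K: "convex K" "compact K" "interior K \<noteq> {}"
  shows "\<exists>p q. halving_pair (frontier K) p q"
proof -
  obtain g where g: "simple_path g" "pathfinish g = pathstart g" "path_image g = frontier K"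
    using frontier_simple_loop[OF K] .
  have cl: "closed K" using K by (simp add: compact_imp_closed)
  then have fr: "frontier K = K - interior K" by (simp add: frontier_def)
  have p: "g 0 \<in> frontier K" using g(3) by (auto simp: path_image_def)
  have g1: "g 1 = g 0" using g(2) by (simp add: pathstart_def pathfinish_def)
  obtain m where m: "m \<in> interior K" using K(3) by auto
  then have mK: "m \<in> K" using interior_subset by blast
  have mp: "m \<noteq> g 0" using m p fr by auto
  \<comment> \<open>The second end of the chord: the ray from \<open>g 0\<close> through
    \<open>m\<close> is followed to an exit point.\<close>
  obtain s where s: "0 \<le> s" "m + s *\<^sub>R (m - g 0) \<in> frontier K"
    using exit_point_frontier[OF K(2) mK, of "m - g 0"] mp by auto
  obtain t where t: "t \<in> {0..1}" "g t = m + s *\<^sub>R (m - g 0)"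
    using s(2) unfolding g(3)[symmetric] path_image_def by (metis imageE)
  have gt: "g t - g 0 = (1 + s) *\<^sub>R (m - g 0)" by (simp add: t algebra_simps)
  then have ne: "g t \<noteq> g 0" using mp s by auto
  then have t01: "t \<in> {0<..<1}" using t g1 by (cases "t = 0"; cases "t = 1") auto
  have "m \<in> open_segment (g 0) (g t)"
  proof -
    have "s > 0" using s m fr by (cases "s = 0") auto
    have "m = g 0 + (1 / (1 + s)) *\<^sub>R (g t - g 0)" using s by (simp add: gt)
    then have "m = (1 - 1 / (1 + s)) *\<^sub>R g 0 + (1 / (1 + s)) *\<^sub>R g t" by (simp add: algebra_simps)
    then show ?thesis
      unfolding in_segment using ne \<open>s > 0\<close> by (intro conjI exI[of _ "1 / (1 + s)"]) auto
  qed
  then have seg: "open_segment (g 0) (g t) \<subseteq> interior K"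
    using open_segment_interior_or_frontier[OF K(1) cl, of "g 0" "g t"] p s t fr m by auto
  obtain n where "chord_arcs K (g 0) (g t) n (subpath 0 t g) (subpath t 1 g)"
    using simple_loop_chord_arcs[OF K(1,2) g t01 seg] .
  then have "path_length (subpath 0 t g) < \<infinity>" "path_length (subpath t 1 g) < \<infinity>"
    using chord_arcs.path_length_arc_finite chord_arcs.swapped by blast+
  then have fin: "path_length g < \<infinity>"
    using path_length_split[OF t(1), of g] by (simp add: ennreal_add_less_top)
  have "0 < ennreal (dist (g 0) (g t) + dist (g t) (g 1))"
    using ne by (simp add: g1 dist_commute)
  then have pos: "0 < path_length g"
    using path_length_ge_2[OF t(1), of g] by (rule less_le_trans)
  obtain r where "r \<in> {0<..<1}" "path_length (subpath 0 r g) = path_length g / 2"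
    "path_length (subpath r 1 g) = path_length g / 2"
    using path_bisection[OF simple_path_imp_path[OF g(1)] fin pos] .
  then show ?thesis
    unfolding halving_pair_def using g by (intro exI[of _ "g 0"] exI[of _ "g r"] exI[of _ g] exI[of _ r])
      (auto simp: pathstart_def)
qed

lemma measure_le_halving_chord:
  fixes K :: "(real^2) set"
  assumes K: "convex K" "compact K" "interior K \<noteq> {}" and hp: "halving_pair (frontier K) p q"
  shows "measure lebesgue K \<le> diameter (frontier K) * dist p q"
proof -
  obtain g t where g: "simple_path g" "pathfinish g = pathstart g" "path_image g = frontier K"
    and t: "t \<in> {0<..<1}" and pq: "pathstart g = p" "g t = q"
    and len: "path_length (subpath 0 t g) = path_length g / 2" "path_length (subpath t 1 g) = path_length g / 2"
    using hp unfolding halving_pair_def by blast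
  note arcs = simple_loop_arcs[OF g(1,2) t]
  have g0: "g 0 = p" using pq by (simp add: pathstart_def)
  have "open_segment (g 0) (g t) \<subseteq> interior K"
    by (rule halving_segment_interior[OF _ K arcs(2,6,7,3,8,9)]) (simp_all add: arcs g len)
  then obtain n where "chord_arcs K (g 0) (g t) n (subpath 0 t g) (subpath t 1 g)"
    using simple_loop_chord_arcs[OF K(1,2) g t] by blast
  then show ?thesis
    using chord_arcs.measure_le_diameter len g0 pq by metis
qed

theorem theorem7:
  fixes C :: "(real^2) set"
  assumes "closed_convex_curve C"
  shows "enclosed_area C \<le> diameter C * min_halving_distance C"
proof -
  obtain K where K: "convex K" "compact K" "interior K \<noteq> {}" and C: "C = frontier K"
    using assms unfolding closed_convex_curve_def by blast
  define A where "A = enclosed_area C"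
  have "inside C = interior K"
    unfolding C using K by (intro inside_frontier_eq_interior) (auto simp: compact_imp_bounded)
  then have "A \<le> measure lebesgue K"
    unfolding A_def enclosed_area_def using K(2)
    by (intro measure_mono_fmeasurable) (auto simp: interior_subset lmeasurable_compact)
  then have le: "A \<le> diameter C * dist p q" if "halving_pair C p q" for p q
    using measure_le_halving_chord[OF K, of p q] that by (simp add: C)
  \<comment> \<open>An infimum over an empty set would carry no information, so existence of a
    halving pair is essential.\<close>
  obtain p0 q0 where pq0: "halving_pair C p0 q0" using halving_pair_exists[OF K] C by blast
  have "0 \<le> diameter C"
    unfolding C using K(2) by (intro diameter_ge_0 compact_imp_bounded compact_frontier)
  then consider "diameter C = 0" | "0 < diameter C" by linarith
  then show ?thesis
  proof cases
    case 1
    then show ?thesis using le[OF pq0] by (simp add: A_def)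
  next
    case 2
    \<comment> \<open>After division by the positive diameter, the bound for each halving pair
      becomes a lower bound of the set whose infimum is taken.\<close>
    have "A / diameter C \<le> min_halving_distance C"
      unfolding min_halving_distance_def
    proof (rule cInf_greatest)
      show "{dist p q |p q. halving_pair C p q} \<noteq> {}" using pq0 by blast
      fix d assume "d \<in> {dist p q |p q. halving_pair C p q}"
      then show "A / diameter C \<le> d" using le 2 by (auto simp: divide_le_eq mult.commute)
    qed
    then show ?thesis using 2 by (simp add: A_def divide_le_eq mult.commute)
  qed
qed

end
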